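(* Let $(E,\|\cdot\|)$ be a $\mathcal T_{\varepsilon,\lambda}$-complete $RN$ module with base $(\Omega,\mathcal F,P)$, $G$ a $\mathcal T_{\varepsilon,\lambda}$-closed $L^0$-convex subset of $E$, and $S$ and $T$ two mappings from $G$ to $E$ such that the following three conditions are satisfied: (1) $S$ is random contractive, namely there exists $\alpha\in L^0_+(\mathcal F)$ with $\alpha<1$ on $\Omega$ such that $\|S(x)-S(y)\|\le\alpha\|x-y\|$ for all $x,y\in G$; (2) $T$ is a $\sigma$-stable and random sequentially continuous mapping such that $T(G)$ is random relatively sequentially compact; (3) $S(x)+T(y)\in G$ for any $x$ and $y$ in $G$. Then $S+T$ has a fixed point.
   Context: Notation. $(\Omega,\mathcal F,P)$ is a probability space, $\mathbb K$ is $\mathbb R$ or $\mathbb C$. $L^0(\mathcal F,\mathbb K)$ is the algebra of a.s.-equivalence classes of $\mathbb K$-valued $\mathcal F$-measurable random variables; $L^0(\mathcal F)=L^0(\mathcal F,\mathbb R)$, partially ordered by $\xi\le\eta$ iff $\xi(\omega)\le\eta(\omega)$ a.s.; "$\xi<\eta$ on $\Omega$" means $\xi(\omega)<\eta(\omega)$ a.s. $L^0_+(\mathcal F)=\{\xi\in L^0(\mathcal F):\xi\ge 0\}$. $\tilde I_A$ is the equivalence class of the indicator function $I_A$ of $A\in\mathcal F$. $RN$ module. An $RN$ module $(E,\|\cdot\|)$ over $\mathbb K$ with base $(\Omega,\mathcal F,P)$ is a left module $E$ over the algebra $L^0(\mathcal F,\mathbb K)$ with a map $\|\cdot\|:E\to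 L^0_+(\mathcal F)$ such that $\|\xi x\|=|\xi|\,\|x\|$ for all $\xi\in L^0(\mathcal F,\mathbb K)$, $x\in E$; $\|x+y\|\le\|x\|+\|y\|$ for all $x,y\in E$; and $\|x\|=0$ implies $x=\theta$ (the null element). Topology. The $(\varepsilon,\lambda)$-topology $\mathcal T_{\varepsilon,\lambda}$ on $E$ is the metrizable linear topology with local base at $\theta$ given by the sets $\{x\in E: P\{\omega:\|x\|(\omega)<\varepsilon\}>1-\lambda\}$, $\varepsilon>0$, $0<\lambda<1$; so $x_n\to x$ in $\mathcal T_{\varepsilon,\lambda}$ iff $\|x_n-x\|\to 0$ in probability. $L^0$-convexity and $\sigma$-stability. A nonempty $G\subset E$ is $L^0$-convex if $\xi x+(1-\xi)y\in G$ for all $x,y\in G$ and $\xi\in L^0_+(\mathcal F)$ with $0\le\xi\le1$. A countable partition of $\Omega$ to $\mathcal F$ is a sequence $\{A_n,n\in\mathbb N\}$ of pairwise disjoint members of $\mathcal F$ with union $\Omega$. A nonempty $G\subset E$ is $\sigma$-stable if for every sequence $\{x_n\}$ in $G$ and every countable partition $\{A_n\}$ of $\Omega$ to $\mathcal F$ there is $x\in G$ with $\tilde I_{A_n}x=\tilde I_{A_n}x_n$ for all $n$; such $x$ is unique in an $RN$ module and is written $\sum_n\tilde I_{A_n}x_n$. (A $\mathcal T_{\varepsilon,\lambda}$-complete $RN$ module and its $\mathcal T_{\varepsilon,\lambda}$-closed $L^0$-convex subsets are $\sigma$-stable.) Random relative sequential compactness. Let $M$ be a nonempty subset of $E$ contained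 in a $\sigma$-stable subset $H$ of $E$. A random subsequence of a sequence $\{x_n,n\in\mathbb N\}$ in $M$ is a sequence $\{y_k,k\in\mathbb N\}$ in $H$ for which there are positive-integer-valued random variables $n_k$ ($k\in\mathbb N$) on $(\Omega,\mathcal F,P)$ with $n_k(\omega)<n_{k+1}(\omega)$ for all $k\in\mathbb N$, $\omega\in\Omega$, and $y_k=x_{n_k}:=\sum_{l=1}^\infty\tilde I_{(n_k=l)}x_l$ for all $k$. $M$ is random relatively sequentially compact if every sequence in $M$ has a random subsequence converging in $\mathcal T_{\varepsilon,\lambda}$ to some element of $E$. Mappings. For nonempty $G_1,G_2$ in $RN$ modules over the same $\mathbb K$ with the same base, $T:G_1\to G_2$ is $\sigma$-stable if $G_1,G_2$ are $\sigma$-stable and $T(\sum_k\tilde I_{A_k}x_k)=\sum_k\tilde I_{A_k}T(x_k)$ for every countable partition $\{A_k\}$ of $\Omega$ to $\mathcal F$ and every sequence $\{x_k\}$ in $G_1$. $T$ is random sequentially continuous if $G_1$ is $\sigma$-stable and, for every $x_0\in G_1$ and every sequence $\{x_n\}$ in $G_1$ converging in $\mathcal T_{\varepsilon,\lambda}$ to $x_0$, there is a random subsequence $\{x_{n_k}\}$ of $\{x_n\}$ such that $\{T(x_{n_k})\}$ converges in $\mathcal T_{\varepsilon,\lambda}$ to $T(x_0)$. *)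

theory Defs
  imports "HOL-Probability.Probability"
begin

section \<open>Equivalence classes of random variables\<close>

definition ae_eq :: "'w measure \<Rightarrow> (('w \<Rightarrow> 'b::topological_space) \<times> ('w \<Rightarrow> 'b)) set" where
  "ae_eq M = {(f, g). f \<in> borel_measurable M \<and> g \<in> borel_measurable M \<and> (AE w in M. f w = g w)}"

definition L0 :: "'w measure \<Rightarrow> ('w \<Rightarrow> 'b::topological_space) set set" where
  "L0 M = borel_measurable M // ae_eq M"

definition L0_class :: "'w measure \<Rightarrow> ('w \<Rightarrow> 'b::topological_space) \<Rightarrow> ('w \<Rightarrow> 'b) set" where
  "L0_class M f = ae_eq M `` {f}"

text \<open>Pointwise operations, lifted to classes in the usual way: the unions below range over
  representatives, and all the classes in the union coincide as long as the pointwise operation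
  preserves measurability (lemmas \<open>L0_map_class\<close> and \<open>L0_map2_class\<close>).\<close>

definition L0_map ::
  "'w measure \<Rightarrow> ('a \<Rightarrow> 'b::topological_space) \<Rightarrow> ('w \<Rightarrow> 'a) set \<Rightarrow> ('w \<Rightarrow> 'b) set" where
  "L0_map M h X = (\<Union>f\<in>X. L0_class M (\<lambda>w. h (f w)))"

definition L0_map2 ::
  "'w measure \<Rightarrow> ('a \<Rightarrow> 'b \<Rightarrow> 'c::topological_space) \<Rightarrow> ('w \<Rightarrow> 'a) set \<Rightarrow> ('w \<Rightarrow> 'b) set
    \<Rightarrow> ('w \<Rightarrow> 'c) set" where
  "L0_map2 M h X Y = (\<Union>f\<in>X. \<Union>g\<in>Y. L0_class M (\<lambda>w. h (f w) (g w)))"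

abbreviation L0_add where "L0_add M \<equiv> L0_map2 M (+)"
abbreviation L0_diff where "L0_diff M \<equiv> L0_map2 M (-)"
abbreviation L0_mult where "L0_mult M \<equiv> L0_map2 M (*)"
abbreviation L0_abs where "L0_abs M \<equiv> L0_map M norm"
abbreviation L0_const where "L0_const M c \<equiv> L0_class M (\<lambda>_. c)"
abbreviation L0_ind where "L0_ind M A \<equiv> L0_class M (indicator A)"

text \<open>The embedding of real classes into \<open>K\<close>-valued ones.\<close>

abbreviation L0_of_real where "L0_of_real M \<equiv> L0_map M of_real"

definition L0_le :: "'w measure \<Rightarrow> ('w \<Rightarrow> real) set \<Rightarrow> ('w \<Rightarrow> real) set \<Rightarrow> bool" where
  "L0_le M X Y \<longleftrightarrow> (\<exists>f\<in>X. \<exists>g\<in>Y. AE w in M. f w \<le> g w)"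

text \<open>This is ``\<open>X < Y\<close> on \<open>\<Omega>\<close>'', strict almost everywhere, not the strict part of \<open>L0_le\<close>.\<close>

definition L0_less :: "'w measure \<Rightarrow> ('w \<Rightarrow> real) set \<Rightarrow> ('w \<Rightarrow> real) set \<Rightarrow> bool" where
  "L0_less M X Y \<longleftrightarrow> (\<exists>f\<in>X. \<exists>g\<in>Y. AE w in M. f w < g w)"

definition L0_plus :: "'w measure \<Rightarrow> ('w \<Rightarrow> real) set set" where
  "L0_plus M = {X \<in> L0 M. L0_le M (L0_const M 0) X}"


section \<open>RN modules\<close>

text \<open>The scalar field is given by a type \<open>'k\<close> of sort
  \<open>{real_normed_field, euclidean_space}\<close>: \<open>real\<close> and \<open>complex\<close> are instances, and by the
  theorem of Frobenius they are the only ones up to isometric isomorphism.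
  The module \<open>E\<close> is the type \<open>'e\<close>; the laws for the scalar multiplication are only imposed for
  scalars in \<open>L0 M\<close>.\<close>

locale rn_module = prob_space M
  for M :: "'w measure"
    and smul :: "('w \<Rightarrow> 'k::{real_normed_field,euclidean_space}) set \<Rightarrow> 'e::ab_group_add \<Rightarrow> 'e"
    and rnorm :: "'e \<Rightarrow> ('w \<Rightarrow> real) set" +
  assumes smul_add_right: "X \<in> L0 M \<Longrightarrow> smul X (x + y) = smul X x + smul X y"
    and smul_add_left: "X \<in> L0 M \<Longrightarrow> Y \<in> L0 M \<Longrightarrow> smul (L0_add M X Y) x = smul X x + smul Y x"
    and smul_mult: "X \<in> L0 M \<Longrightarrow> Y \<in> L0 M \<Longrightarrow> smul (L0_mult M X Y) x = smul X (smul Y x)"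
    and smul_one: "smul (L0_const M 1) x = x"
    and rnorm_in: "rnorm x \<in> L0_plus M"
    and rnorm_smul: "X \<in> L0 M \<Longrightarrow> rnorm (smul X x) = L0_mult M (L0_abs M X) (rnorm x)"
    and rnorm_triangle: "L0_le M (rnorm (x + y)) (L0_add M (rnorm x) (rnorm y))"
    and rnorm_eq_zero: "rnorm x = L0_const M 0 \<Longrightarrow> x = 0"


section \<open>The \<open>(\<epsilon>, \<lambda>)\<close>-topology\<close>

text \<open>\<open>\<delta>\<close> stands for the parameter \<open>\<lambda>\<close>, which is reserved syntax.\<close>

definition el_nbhd ::
  "'w measure \<Rightarrow> ('e \<Rightarrow> ('w \<Rightarrow> real) set) \<Rightarrow> real \<Rightarrow> real \<Rightarrow> 'e::ab_group_add set" where
  "el_nbhd M rnorm \<epsilon> \<delta> = {x. \<exists>f\<in>rnorm x. measure M {w \<in> space M. f w < \<epsilon>} > 1 - \<delta>}"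

definition el_open ::
  "'w measure \<Rightarrow> ('e \<Rightarrow> ('w \<Rightarrow> real) set) \<Rightarrow> 'e::ab_group_add set \<Rightarrow> bool" where
  "el_open M rnorm U \<longleftrightarrow>
     (\<forall>x\<in>U. \<exists>\<epsilon>>0. \<exists>\<delta>. 0 < \<delta> \<and> \<delta> < 1 \<and> (\<forall>y. y - x \<in> el_nbhd M rnorm \<epsilon> \<delta> \<longrightarrow> y \<in> U))"

definition el_topology ::
  "'w measure \<Rightarrow> ('e \<Rightarrow> ('w \<Rightarrow> real) set) \<Rightarrow> 'e::ab_group_add topology" where
  "el_topology M rnorm = topology (el_open M rnorm)"

definition el_cauchy ::
  "'w measure \<Rightarrow> ('e \<Rightarrow> ('w \<Rightarrow> real) set) \<Rightarrow> (nat \<Rightarrow> 'e::ab_group_add) \<Rightarrow> bool" where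
  "el_cauchy M rnorm x \<longleftrightarrow>
     (\<forall>\<epsilon>>0. \<forall>\<delta>. 0 < \<delta> \<and> \<delta> < 1 \<longrightarrow> (\<exists>N. \<forall>m\<ge>N. \<forall>n\<ge>N. x m - x n \<in> el_nbhd M rnorm \<epsilon> \<delta>))"

text \<open>The topology is linear and metrizable, so completeness is a matter of Cauchy sequences.\<close>

definition el_complete ::
  "'w measure \<Rightarrow> ('e \<Rightarrow> ('w \<Rightarrow> real) set) \<Rightarrow> 'e::ab_group_add itself \<Rightarrow> bool" where
  "el_complete M rnorm (_ :: 'e itself) \<longleftrightarrow>
     (\<forall>x :: nat \<Rightarrow> 'e. el_cauchy M rnorm x \<longrightarrow> (\<exists>l. limitin (el_topology M rnorm) x l sequentially))"


section \<open>\<open>L\<^sup>0\<close>-convexity and \<open>\<sigma>\<close>-stability\<close>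

definition L0_convex ::
  "'w measure \<Rightarrow> (('w \<Rightarrow> 'k::{real_normed_field,euclidean_space}) set \<Rightarrow> 'e::ab_group_add \<Rightarrow> 'e)
    \<Rightarrow> 'e set \<Rightarrow> bool" where
  "L0_convex M smul G \<longleftrightarrow> G \<noteq> {} \<and>
     (\<forall>x\<in>G. \<forall>y\<in>G. \<forall>X\<in>L0_plus M. L0_le M X (L0_const M 1) \<longrightarrow>
        smul (L0_of_real M X) x + smul (L0_diff M (L0_const M 1) (L0_of_real M X)) y \<in> G)"

definition countable_partition :: "'w measure \<Rightarrow> (nat \<Rightarrow> 'w set) \<Rightarrow> bool" where
  "countable_partition M A \<longleftrightarrow>
     range A \<subseteq> sets M \<and> disjoint_family A \<and> (\<Union>n. A n) = space M"

definition sigma_stable ::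
  "'w measure \<Rightarrow> (('w \<Rightarrow> 'k::{real_normed_field,euclidean_space}) set \<Rightarrow> 'e::ab_group_add \<Rightarrow> 'e)
    \<Rightarrow> 'e set \<Rightarrow> bool" where
  "sigma_stable M smul G \<longleftrightarrow> G \<noteq> {} \<and>
     (\<forall>A x. countable_partition M A \<and> range x \<subseteq> G \<longrightarrow>
        (\<exists>y\<in>G. \<forall>n. smul (L0_ind M (A n)) y = smul (L0_ind M (A n)) (x n)))"

text \<open>\<open>conc M smul A x\<close> is the element written \<open>\<Sum>\<^sub>n I\<^sub>A\<^sub>n x\<^sub>n\<close>; it is unique in an RN module
  (lemma \<open>conc_eqI\<close>) and exists whenever the \<open>x n\<close> lie in a \<open>\<sigma>\<close>-stable set.\<close>

definition conc ::
  "'w measure \<Rightarrow> (('w \<Rightarrow> 'k::{real_normed_field,euclidean_space}) set \<Rightarrow> 'e::ab_group_add \<Rightarrow> 'e)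
    \<Rightarrow> (nat \<Rightarrow> 'w set) \<Rightarrow> (nat \<Rightarrow> 'e) \<Rightarrow> 'e" where
  "conc M smul A x = (THE y. \<forall>n. smul (L0_ind M (A n)) y = smul (L0_ind M (A n)) (x n))"


section \<open>Random subsequences and random sequential compactness\<close>

text \<open>Sequences are indexed from 0, so the random indices take values in \<open>nat\<close> including 0.\<close>

definition random_subseq ::
  "'w measure \<Rightarrow> (('w \<Rightarrow> 'k::{real_normed_field,euclidean_space}) set \<Rightarrow> 'e::ab_group_add \<Rightarrow> 'e)
    \<Rightarrow> 'e set \<Rightarrow> (nat \<Rightarrow> 'e) \<Rightarrow> (nat \<Rightarrow> 'e) \<Rightarrow> bool" where
  "random_subseq M smul H x y \<longleftrightarrow> range y \<subseteq> H \<and>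
     (\<exists>n :: nat \<Rightarrow> 'w \<Rightarrow> nat.
        (\<forall>k. n k \<in> measurable M (count_space UNIV)) \<and>
        (\<forall>k. \<forall>w\<in>space M. n k w < n (Suc k) w) \<and>
        (\<forall>k. y k = conc M smul (\<lambda>l. {w \<in> space M. n k w = l}) x))"

definition random_rel_seq_compact ::
  "'w measure \<Rightarrow> (('w \<Rightarrow> 'k::{real_normed_field,euclidean_space}) set \<Rightarrow> 'e::ab_group_add \<Rightarrow> 'e)
    \<Rightarrow> ('e \<Rightarrow> ('w \<Rightarrow> real) set) \<Rightarrow> 'e set \<Rightarrow> bool" where
  "random_rel_seq_compact M smul rnorm C \<longleftrightarrow> C \<noteq> {} \<and>
     (\<exists>H. C \<subseteq> H \<and> sigma_stable M smul H \<and>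
        (\<forall>x. range x \<subseteq> C \<longrightarrow>
           (\<exists>y l. random_subseq M smul H x y \<and> limitin (el_topology M rnorm) y l sequentially)))"


section \<open>Mappings\<close>

text \<open>A mapping defined on a subset \<open>G\<close> is a total function of which only the values on \<open>G\<close>
  matter.\<close>

definition random_contractive ::
  "'w measure \<Rightarrow> ('e \<Rightarrow> ('w \<Rightarrow> real) set) \<Rightarrow> 'e set \<Rightarrow> ('e \<Rightarrow> 'e::ab_group_add) \<Rightarrow> bool" where
  "random_contractive M rnorm G S \<longleftrightarrow>
     (\<exists>\<alpha>\<in>L0_plus M. L0_less M \<alpha> (L0_const M 1) \<and>
        (\<forall>x\<in>G. \<forall>y\<in>G. L0_le M (rnorm (S x - S y)) (L0_mult M \<alpha> (rnorm (x - y)))))"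

definition sigma_stable_map ::
  "'w measure \<Rightarrow> (('w \<Rightarrow> 'k::{real_normed_field,euclidean_space}) set \<Rightarrow> 'e::ab_group_add \<Rightarrow> 'e)
    \<Rightarrow> 'e set \<Rightarrow> 'e set \<Rightarrow> ('e \<Rightarrow> 'e) \<Rightarrow> bool" where
  "sigma_stable_map M smul G1 G2 T \<longleftrightarrow>
     T ` G1 \<subseteq> G2 \<and> sigma_stable M smul G1 \<and> sigma_stable M smul G2 \<and>
     (\<forall>A x. countable_partition M A \<and> range x \<subseteq> G1 \<longrightarrow>
        T (conc M smul A x) = conc M smul A (\<lambda>n. T (x n)))"

definition random_seq_continuous ::
  "'w measure \<Rightarrow> (('w \<Rightarrow> 'k::{real_normed_field,euclidean_space}) set \<Rightarrow> 'e::ab_group_add \<Rightarrow> 'e)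
    \<Rightarrow> ('e \<Rightarrow> ('w \<Rightarrow> real) set) \<Rightarrow> 'e set \<Rightarrow> ('e \<Rightarrow> 'e) \<Rightarrow> bool" where
  "random_seq_continuous M smul rnorm G T \<longleftrightarrow> sigma_stable M smul G \<and>
     (\<forall>x0\<in>G. \<forall>x. range x \<subseteq> G \<and> limitin (el_topology M rnorm) x x0 sequentially \<longrightarrow>
        (\<exists>y. random_subseq M smul G x y \<and>
             limitin (el_topology M rnorm) (\<lambda>k. T (y k)) (T x0) sequentially))"


section \<open>Well-definedness\<close>

lemma ae_eq_equiv: "equiv (borel_measurable M) (ae_eq M)"
proof (rule equivI)
  show "trans (ae_eq M)"
    by (rule transI) (auto simp: ae_eq_def elim: eventually_elim2)
qed (auto simp: ae_eq_def refl_on_def sym_def eq_commute)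

lemma L0_class_eq_iff:
  assumes "f \<in> borel_measurable M" "g \<in> borel_measurable M"
  shows "L0_class M f = L0_class M g \<longleftrightarrow> (AE w in M. f w = g w)"
  using eq_equiv_class_iff[OF ae_eq_equiv assms] assms by (auto simp: L0_class_def ae_eq_def)

lemma L0_class_self: "f \<in> borel_measurable M \<Longrightarrow> f \<in> L0_class M f"
  by (simp add: L0_class_def ae_eq_def)

lemma mem_L0_class:
  assumes "f \<in> borel_measurable M"
  shows "g \<in> L0_class M f \<longleftrightarrow> g \<in> borel_measurable M \<and> (AE w in M. f w = g w)"
  using assms by (simp add: L0_class_def ae_eq_def)

lemma L0_class_in: "f \<in> borel_measurable M \<Longrightarrow> L0_class M f \<in> L0 M"
  by (simp add: L0_class_def L0_def quotientI)

lemma L0_cases: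
  assumes "X \<in> L0 M"
  obtains f where "f \<in> borel_measurable M" "X = L0_class M f"
  using assms by (auto simp: L0_def L0_class_def elim: quotientE)

lemma L0_map_class:
  assumes f: "f \<in> borel_measurable M" and h: "h \<in> borel_measurable borel"
  shows "L0_map M h (L0_class M f) = L0_class M (\<lambda>w. h (f w))"
proof -
  have "L0_class M (\<lambda>w. h (f' w)) = L0_class M (\<lambda>w. h (f w))" if "f' \<in> L0_class M f" for f'
  proof (subst L0_class_eq_iff)
    have f': "f' \<in> borel_measurable M" "AE w in M. f w = f' w"
      using that by (auto simp: mem_L0_class[OF f])
    show "(\<lambda>w. h (f' w)) \<in> borel_measurable M" "(\<lambda>w. h (f w)) \<in> borel_measurable M"
      using f' f h by measurable
    show "AE w in M. h (f' w) = h (f w)"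
      using f'(2) by eventually_elim simp
  qed
  then show ?thesis
    unfolding L0_map_def by (intro UN_constant_eq[OF L0_class_self[OF f]] ballI)
qed

lemma L0_map2_class:
  assumes f: "f \<in> borel_measurable M" and g: "g \<in> borel_measurable M"
    and h: "\<And>f g. f \<in> borel_measurable M \<Longrightarrow> g \<in> borel_measurable M \<Longrightarrow>
              (\<lambda>w. h (f w) (g w)) \<in> borel_measurable M"
  shows "L0_map2 M h (L0_class M f) (L0_class M g) = L0_class M (\<lambda>w. h (f w) (g w))"
proof -
  have "L0_class M (\<lambda>w. h (f' w) (g' w)) = L0_class M (\<lambda>w. h (f w) (g w))"
    if "f' \<in> L0_class M f" "g' \<in> L0_class M g" for f' g'
  proof (subst L0_class_eq_iff)
    have f': "f' \<in> borel_measurable M" "AE w in M. f w = f' w"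
      and g': "g' \<in> borel_measurable M" "AE w in M. g w = g' w"
      using that by (auto simp: mem_L0_class[OF f] mem_L0_class[OF g])
    show "(\<lambda>w. h (f' w) (g' w)) \<in> borel_measurable M" "(\<lambda>w. h (f w) (g w)) \<in> borel_measurable M"
      using f' g' f g h by auto
    show "AE w in M. h (f' w) (g' w) = h (f w) (g w)"
      using f'(2) g'(2) by eventually_elim simp
  qed
  then show ?thesis
    unfolding L0_map2_def
    by (intro UN_constant_eq[OF L0_class_self[OF f]] UN_constant_eq[OF L0_class_self[OF g]] ballI)
qed

lemma el_nbhd_mono:
  assumes "prob_space M" "\<And>x. rnorm x \<in> L0 M" "\<epsilon> \<le> \<epsilon>'" "\<delta> \<le> \<delta>'"
  shows "el_nbhd M rnorm \<epsilon> \<delta> \<subseteq> el_nbhd M rnorm \<epsilon>' \<delta>'"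
proof
  interpret prob_space M by fact
  fix x assume "x \<in> el_nbhd M rnorm \<epsilon> \<delta>"
  then obtain f where f: "f \<in> rnorm x" "measure M {w \<in> space M. f w < \<epsilon>} > 1 - \<delta>"
    by (auto simp: el_nbhd_def)
  have [measurable]: "f \<in> borel_measurable M"
    using f(1) assms(2)[of x] by (auto elim!: L0_cases simp: mem_L0_class)
  have "measure M {w \<in> space M. f w < \<epsilon>} \<le> measure M {w \<in> space M. f w < \<epsilon>'}"
    using assms(3) by (intro finite_measure_mono) auto
  then show "x \<in> el_nbhd M rnorm \<epsilon>' \<delta>'"
    using f assms(4) by (auto simp: el_nbhd_def intro!: bexI[of _ f])
qed

context rn_module
begin

lemma rnorm_L0: "rnorm x \<in> L0 M"
  using rnorm_in by (auto simp: L0_plus_def)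

lemma rnorm_rep:
  obtains f where "f \<in> borel_measurable M" "rnorm x = L0_class M f" "f \<in> rnorm x"
proof -
  obtain f where "f \<in> borel_measurable M" "rnorm x = L0_class M f"
    by (rule L0_cases[OF rnorm_L0])
  then show ?thesis
    by (intro that[of f]) (auto intro: L0_class_self)
qed

lemma rnorm_rep_measurable: "f \<in> rnorm x \<Longrightarrow> f \<in> borel_measurable M"
  by (rule rnorm_rep[of x]) (simp add: mem_L0_class)

lemma rnorm_eq_class:
  assumes "f \<in> rnorm x"
  shows "rnorm x = L0_class M f"
proof -
  obtain g where g: "g \<in> borel_measurable M" "rnorm x = L0_class M g" by (rule rnorm_rep)
  then have "f \<in> borel_measurable M" "AE w in M. g w = f w"
    using assms by (simp_all add: mem_L0_class)
  then show ?thesis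
    using g by (simp add: L0_class_eq_iff)
qed

lemma smul_zero_left: "smul (L0_const M 0) x = 0"
proof -
  have z: "L0_const M (0::'k) \<in> L0 M" by (simp add: L0_class_in)
  have "L0_add M (L0_const M (0::'k)) (L0_const M 0) = L0_const M 0"
    by (subst L0_map2_class) auto
  then show ?thesis
    using smul_add_left[OF z z, of x] by simp
qed

lemma rnorm_zero: "rnorm 0 = L0_const M 0"
proof -
  obtain f where f: "f \<in> borel_measurable M" "rnorm 0 = L0_class M f" by (rule rnorm_rep)
  have z: "L0_const M (0::'k) \<in> L0 M" by (simp add: L0_class_in)
  have "rnorm 0 = L0_mult M (L0_abs M (L0_const M (0::'k))) (rnorm 0)"
    using rnorm_smul[OF z, of 0] by (simp add: smul_zero_left)
  also have "L0_abs M (L0_const M (0::'k)) = L0_const M 0"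
    by (subst L0_map_class) auto
  also have "L0_mult M (L0_const M 0) (rnorm 0) = L0_const M 0"
    unfolding f(2) using f(1) by (subst L0_map2_class) auto
  finally show ?thesis .
qed

lemma zero_in_el_nbhd: "\<epsilon> > 0 \<Longrightarrow> \<delta> > 0 \<Longrightarrow> 0 \<in> el_nbhd M rnorm \<epsilon> \<delta>"
  unfolding el_nbhd_def
  by (intro CollectI bexI[of _ "\<lambda>_. 0"]) (simp_all add: rnorm_zero prob_space L0_class_self)

lemma el_nbhd_add:
  assumes "x \<in> el_nbhd M rnorm \<epsilon>1 \<delta>1" "y \<in> el_nbhd M rnorm \<epsilon>2 \<delta>2"
  shows "x + y \<in> el_nbhd M rnorm (\<epsilon>1 + \<epsilon>2) (\<delta>1 + \<delta>2)"
proof -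
  obtain f where f: "f \<in> rnorm x" "measure M {w \<in> space M. f w < \<epsilon>1} > 1 - \<delta>1"
    using assms by (auto simp: el_nbhd_def)
  obtain g where g: "g \<in> rnorm y" "measure M {w \<in> space M. g w < \<epsilon>2} > 1 - \<delta>2"
    using assms by (auto simp: el_nbhd_def)
  have [measurable]: "f \<in> borel_measurable M" "g \<in> borel_measurable M"
    using f g rnorm_rep_measurable by auto
  obtain h k where h: "h \<in> rnorm (x + y)" "k \<in> L0_add M (rnorm x) (rnorm y)" "AE w in M. h w \<le> k w"
    using rnorm_triangle[of x y] by (auto simp: L0_le_def)
  have [measurable]: "h \<in> borel_measurable M"
    using h rnorm_rep_measurable by auto
  have cl: "rnorm x = L0_class M f" "rnorm y = L0_class M g"
    by (rule rnorm_eq_class[OF f(1)], rule rnorm_eq_class[OF g(1)])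
  have "k \<in> L0_class M (\<lambda>w. f w + g w)"
    using h(2) unfolding cl by (subst (asm) L0_map2_class) auto
  then have "AE w in M. f w + g w = k w"
    by (subst (asm) mem_L0_class) auto
  with h(3) have le: "AE w in M. h w \<le> f w + g w"
    by eventually_elim simp
  let ?A = "{w \<in> space M. f w < \<epsilon>1}" and ?B = "{w \<in> space M. g w < \<epsilon>2}"
  have "prob ?A + prob ?B \<le> prob (?A \<inter> ?B) + 1"
    using measure_Un3[of ?A M ?B] prob_le_1[of "?A \<union> ?B"] by (simp add: fmeasurable_eq_sets)
  moreover have "prob (?A \<inter> ?B) \<le> prob {w \<in> space M. h w < \<epsilon>1 + \<epsilon>2}"
    using le by (intro finite_measure_mono_AE) auto
  ultimately show ?thesis
    using f g h(1) by (auto simp: el_nbhd_def intro!: bexI[of _ h])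
qed

lemma istopology_el_open: "istopology (el_open M rnorm)"
  unfolding istopology_def
proof (intro conjI allI impI)
  fix U V assume U: "el_open M rnorm U" and V: "el_open M rnorm V"
  show "el_open M rnorm (U \<inter> V)"
    unfolding el_open_def
  proof
    fix x assume x: "x \<in> U \<inter> V"
    obtain a b where a: "a > 0" "0 < b" "b < 1" "\<forall>y. y - x \<in> el_nbhd M rnorm a b \<longrightarrow> y \<in> U"
      using U x unfolding el_open_def by blast
    obtain c d where c: "c > 0" "0 < d" "d < 1" "\<forall>y. y - x \<in> el_nbhd M rnorm c d \<longrightarrow> y \<in> V"
      using V x unfolding el_open_def by blast
    have "el_nbhd M rnorm (min a c) (min b d) \<subseteq> el_nbhd M rnorm a b \<inter> el_nbhd M rnorm c d"
      by (intro Int_greatest el_nbhd_mono prob_space_axioms rnorm_L0) auto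
    then show "\<exists>\<epsilon>>0. \<exists>\<delta>. 0 < \<delta> \<and> \<delta> < 1 \<and> (\<forall>y. y - x \<in> el_nbhd M rnorm \<epsilon> \<delta> \<longrightarrow> y \<in> U \<inter> V)"
      using a c by (intro exI[of _ "min a c"] conjI exI[of _ "min b d"]) auto
  qed
next
  fix K assume K: "\<forall>U\<in>K. el_open M rnorm U"
  show "el_open M rnorm (\<Union>K)"
    unfolding el_open_def
  proof
    fix x assume "x \<in> \<Union>K"
    then obtain U where U: "U \<in> K" "x \<in> U" by blast
    then obtain a b where "a > 0" "0 < b" "b < 1" "\<forall>y. y - x \<in> el_nbhd M rnorm a b \<longrightarrow> y \<in> U"
      using K unfolding el_open_def by blast
    then show "\<exists>\<epsilon>>0. \<exists>\<delta>. 0 < \<delta> \<and> \<delta> < 1 \<and> (\<forall>y. y - x \<in> el_nbhd M rnorm \<epsilon> \<delta> \<longrightarrow> y \<in> \<Union>K)"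
      using U by blast
  qed
qed

lemma openin_el_topology: "openin (el_topology M rnorm) U \<longleftrightarrow> el_open M rnorm U"
  by (simp add: el_topology_def istopology_el_open topology_inverse')

lemma topspace_el_topology: "topspace (el_topology M rnorm) = UNIV"
proof -
  have "el_open M rnorm UNIV"
    unfolding el_open_def by (auto intro: exI[of _ 1] exI[of _ "1/2"])
  then show ?thesis
    using openin_subset[of "el_topology M rnorm" UNIV] by (simp add: openin_el_topology top.extremum_unique)
qed

text \<open>The sets \<open>el_nbhd M rnorm \<epsilon> \<delta>\<close> do form a local base at 0, and convergence is
  convergence in probability of the norms.\<close>

lemma el_nbhd_base:
  assumes "\<epsilon> > 0" "0 < \<delta>" "\<delta> < 1"
  shows "\<exists>U. openin (el_topology M rnorm) U \<and> l \<in> U \<and> (\<forall>y\<in>U. y - l \<in> el_nbhd M rnorm \<epsilon> \<delta>)"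
proof -
  define U where "U = {y. \<exists>a>0. \<exists>b. 0 < b \<and> b < 1 \<and>
    (\<forall>z. z - y \<in> el_nbhd M rnorm a b \<longrightarrow> z - l \<in> el_nbhd M rnorm \<epsilon> \<delta>)}"
  have "el_open M rnorm U"
    unfolding el_open_def
  proof
    fix y assume "y \<in> U"
    then obtain a b where ab: "a > 0" "0 < b" "b < 1"
      and *: "\<And>z. z - y \<in> el_nbhd M rnorm a b \<Longrightarrow> z - l \<in> el_nbhd M rnorm \<epsilon> \<delta>"
      unfolding U_def by blast
    have "v \<in> U" if v: "v - y \<in> el_nbhd M rnorm (a/2) (b/2)" for v
    proof -
      have "z - l \<in> el_nbhd M rnorm \<epsilon> \<delta>" if "z - v \<in> el_nbhd M rnorm (a/2) (b/2)" for z
        using el_nbhd_add[OF that v] by (intro *) simp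
      then show ?thesis
        unfolding U_def using ab by (intro CollectI exI[of _ "a/2"] conjI exI[of _ "b/2"]) auto
    qed
    then show "\<exists>\<epsilon>>0. \<exists>\<delta>. 0 < \<delta> \<and> \<delta> < 1 \<and> (\<forall>v. v - y \<in> el_nbhd M rnorm \<epsilon> \<delta> \<longrightarrow> v \<in> U)"
      using ab by (intro exI[of _ "a/2"] conjI exI[of _ "b/2"]) auto
  qed
  moreover have "l \<in> U"
    unfolding U_def using assms by blast
  moreover have "y - l \<in> el_nbhd M rnorm \<epsilon> \<delta>" if "y \<in> U" for y
  proof -
    from that obtain a b where "a > 0" "b > 0"
      "\<And>z. z - y \<in> el_nbhd M rnorm a b \<Longrightarrow> z - l \<in> el_nbhd M rnorm \<epsilon> \<delta>"
      unfolding U_def by blast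
    then show ?thesis
      using zero_in_el_nbhd[of a b] by simp
  qed
  ultimately show ?thesis
    by (auto simp: openin_el_topology)
qed

lemma limitin_el_topology:
  "limitin (el_topology M rnorm) x l sequentially \<longleftrightarrow>
     (\<forall>\<epsilon>>0. \<forall>\<delta>. 0 < \<delta> \<and> \<delta> < 1 \<longrightarrow> (\<forall>\<^sub>F n in sequentially. x n - l \<in> el_nbhd M rnorm \<epsilon> \<delta>))"
  (is "?L \<longleftrightarrow> ?R")
proof
  assume L: ?L
  show ?R
  proof (intro allI impI)
    fix \<epsilon> \<delta> :: real assume *: "\<epsilon> > 0" "0 < \<delta> \<and> \<delta> < 1"
    obtain U where U: "openin (el_topology M rnorm) U" "l \<in> U"
      "\<forall>y\<in>U. y - l \<in> el_nbhd M rnorm \<epsilon> \<delta>"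
      using el_nbhd_base[of \<epsilon> \<delta> l] * by auto
    then have "\<forall>\<^sub>F n in sequentially. x n \<in> U"
      using L by (auto simp: limitin_def)
    then show "\<forall>\<^sub>F n in sequentially. x n - l \<in> el_nbhd M rnorm \<epsilon> \<delta>"
      by eventually_elim (use U in auto)
  qed
next
  assume R: ?R
  have "\<forall>\<^sub>F n in sequentially. x n \<in> U" if U: "el_open M rnorm U" "l \<in> U" for U
  proof -
    obtain a b where ab: "a > 0" "0 < b" "b < 1" "\<forall>y. y - l \<in> el_nbhd M rnorm a b \<longrightarrow> y \<in> U"
      using U unfolding el_open_def by blast
    then have "\<forall>\<^sub>F n in sequentially. x n - l \<in> el_nbhd M rnorm a b"
      using R by blast
    then show ?thesis
      by eventually_elim (use ab in auto)
  qed
  then show ?L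
    by (auto simp: limitin_def openin_el_topology topspace_el_topology)
qed

lemma conc_eqI:
  assumes A: "countable_partition M A"
    and y: "\<And>n. smul (L0_ind M (A n)) y = smul (L0_ind M (A n)) (x n)"
  shows "conc M smul A x = y"
  unfolding conc_def
proof (rule the_equality)
  show "\<forall>n. smul (L0_ind M (A n)) y = smul (L0_ind M (A n)) (x n)"
    using y by blast
  fix z assume z: "\<forall>n. smul (L0_ind M (A n)) z = smul (L0_ind M (A n)) (x n)"
  obtain f where [measurable]: "f \<in> borel_measurable M" and f: "rnorm (z - y) = L0_class M f"
    by (rule rnorm_rep)
  have "AE w in M. w \<in> A n \<longrightarrow> f w = 0" for n
  proof -
    have [measurable]: "A n \<in> sets M"
      using A by (auto simp: countable_partition_def)
    have I: "L0_ind M (A n) \<in> (L0 M :: ('w \<Rightarrow> 'k) set set)"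
      by (simp add: L0_class_in)
    have "smul (L0_ind M (A n)) ((z - y) + y) = smul (L0_ind M (A n)) (z - y) + smul (L0_ind M (A n)) y"
      by (rule smul_add_right[OF I])
    then have "smul (L0_ind M (A n)) (z - y) = 0"
      using z y by simp
    then have "L0_const M 0 = L0_mult M (L0_abs M (L0_ind M (A n) :: ('w \<Rightarrow> 'k) set)) (rnorm (z - y))"
      using rnorm_smul[OF I, of "z - y"] by (simp add: rnorm_zero)
    also have "L0_abs M (L0_ind M (A n) :: ('w \<Rightarrow> 'k) set) = L0_class M (\<lambda>w. norm (indicator (A n) w :: 'k))"
      by (subst L0_map_class) auto
    also have "L0_mult M \<dots> (rnorm (z - y)) = L0_class M (\<lambda>w. norm (indicator (A n) w :: 'k) * f w)"
      unfolding f by (subst L0_map2_class) auto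
    finally have "AE w in M. 0 = norm (indicator (A n) w :: 'k) * f w"
      by (subst (asm) L0_class_eq_iff) auto
    then show ?thesis
      by eventually_elim auto
  qed
  then have "AE w in M. \<forall>n. w \<in> A n \<longrightarrow> f w = 0"
    by (intro AE_all_countable[THEN iffD2] allI)
  then have "AE w in M. f w = 0"
  proof (rule AE_mp, intro AE_I2 impI)
    fix w assume "w \<in> space M" "\<forall>n. w \<in> A n \<longrightarrow> f w = 0"
    then show "f w = 0"
      using A unfolding countable_partition_def by blast
  qed
  then have "rnorm (z - y) = L0_const M 0"
    unfolding f by (subst L0_class_eq_iff) auto
  then show "z = y"
    using rnorm_eq_zero[of "z - y"] by simp
qed

end

end

theory Submission
  imports Defs
begin

text \<open>
  Fix representatives \<open>nrm x\<close> of the random norms; then \<open>nrm (x - y) w\<close> is, for almost every sample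
  point \<open>w\<close>, a pseudometric on any given countable set, and all limits can be taken almost surely
  after passing to subsequences. Since \<open>S\<close> is random contractive, \<open>S x + T y = x\<close> has a unique
  solution \<open>x\<close> in \<open>G\<close>, written \<open>resolvent y\<close>, with
  \<open>(1 - lip) nrm (resolvent x - resolvent y) \<le> nrm (T x - T y)\<close>; a fixed point of the resolvent is a
  fixed point of \<open>S + T\<close>.

  Gluing elements of \<open>G\<close> along a measurable choice of indices (\<open>\<sigma>\<close>-stability) turns the random
  hypotheses on \<open>T\<close> into pointwise ones: on a countable subset of \<open>G\<close>, for almost every \<open>w\<close>, the image
  of \<open>T\<close> is totally bounded and \<open>T\<close> is uniformly continuous on rational polytopes, for otherwise the
  first witnesses to the contrary could be glued to a sequence contradicting the hypothesis.
  So on a countable subset of \<open>G\<close> that is closed under rational convex combinations and the resolvent,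
  Schauder's argument, with Kuhn's combinatorial lemma on rational grids in place of Brouwer's theorem,
  yields approximate fixed points of the resolvent separately at almost every \<open>w\<close>.
  The first of them in an enumeration depends measurably on \<open>w\<close>, so they glue to
  \<open>u\<^sub>m \<in> G\<close> with \<open>nrm (u\<^sub>m - resolvent u\<^sub>m) < 1 / (m + 1)\<close> almost surely, and compactness gives the limit.
\<close>

section \<open>Approximate fixed points over the rationals\<close>

text \<open>Rational coordinates, because convex combinations with rational weights of finitely many
  points form a countable set, on which almost sure statements hold simultaneously.\<close>

definition rcube :: "nat \<Rightarrow> (nat \<Rightarrow> real) set" where
  "rcube n = {c. \<forall>i<n. c i \<in> \<rat> \<and> 0 \<le> c i \<and> c i \<le> 1}"

text \<open>Over the rationals only approximate fixed points can be expected. Kuhn's lemma on a fine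
  grid yields a cell in which, for every coordinate \<open>i\<close>, one vertex has coordinate
  \<open>i\<close> not decreased by \<open>F\<close> and another has it not increased; uniform
  continuity makes \<open>F c i - c i\<close> small at the corner \<open>q\<close> of that
  cell.\<close>

lemma brouwer_rcube:
  fixes F :: "(nat \<Rightarrow> real) \<Rightarrow> nat \<Rightarrow> real"
  assumes F: "\<And>c i. c \<in> rcube n \<Longrightarrow> i < n \<Longrightarrow> 0 \<le> F c i \<and> F c i \<le> 1"
    and uc: "\<And>\<eta>. \<eta> > 0 \<Longrightarrow> \<exists>\<delta>>0. \<forall>c\<in>rcube n. \<forall>d\<in>rcube n.
      (\<forall>i<n. \<bar>c i - d i\<bar> < \<delta>) \<longrightarrow> (\<forall>i<n. \<bar>F c i - F d i\<bar> < \<eta>)"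
    and "\<eta> > 0"
  shows "\<exists>c\<in>rcube n. \<forall>i<n. \<bar>F c i - c i\<bar> < \<eta>"
proof -
  obtain \<delta> where "\<delta> > 0" and \<delta>: "\<And>c d i. c \<in> rcube n \<Longrightarrow> d \<in> rcube n \<Longrightarrow>
      (\<And>j. j < n \<Longrightarrow> \<bar>c j - d j\<bar> < \<delta>) \<Longrightarrow> i < n \<Longrightarrow> \<bar>F c i - F d i\<bar> < \<eta> / 2"
    using uc[of "\<eta>/2"] \<open>\<eta> > 0\<close> by (metis half_gt_zero)
  obtain p' where p': "1 / real (Suc p') < min \<delta> (\<eta> / 2)"
    using nat_approx_posE[of "min \<delta> (\<eta>/2)"] \<open>\<eta> > 0\<close> \<open>\<delta> > 0\<close> by auto
  define p where "p = Suc p'"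
  have p: "p > 0" "1 / real p < \<delta>" "1 / real p < \<eta> / 2"
    using p' by (simp_all add: p_def)
  define pt :: "(nat \<Rightarrow> nat) \<Rightarrow> nat \<Rightarrow> real" where "pt x i = real (x i) / real p" for x i
  have pt: "pt x \<in> rcube n" if "\<forall>i<n. x i \<le> p" for x
    using that p(1) by (auto simp: rcube_def pt_def)
  \<comment> \<open>Label 0 means that \<open>F\<close> does not decrease coordinate
    \<open>i\<close>. On the face \<open>x i = p\<close> Kuhn's lemma demands label 1, which is
    consistent with \<open>l1\<close> since there \<open>pt x i = 1\<close>.\<close>
  define label where "label x i = (if pt x i \<le> F (pt x) i \<and> x i \<noteq> p then 0 else 1::nat)" for x i
  have l0: "pt x i \<le> F (pt x) i" if "label x i = 0" for x i
    using that by (simp add: label_def split: if_splits)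
  have l1: "F (pt x) i \<le> pt x i" if "label x i \<noteq> 0" "\<forall>i<n. x i \<le> p" "i < n" for x i
    using that F[OF pt[OF that(2)] that(3)] p(1) by (auto simp: label_def pt_def split: if_splits)
  obtain q where q: "\<forall>i<n. q i < p" and rs: "\<forall>i<n. \<exists>r s. (\<forall>j<n. q j \<le> r j \<and> r j \<le> q j + 1) \<and>
      (\<forall>j<n. q j \<le> s j \<and> s j \<le> q j + 1) \<and> label r i \<noteq> label s i"
  proof (rule kuhn_lemma[of p n label])
    show "\<forall>x. (\<forall>i<n. x i \<le> p) \<longrightarrow> (\<forall>i<n. x i = 0 \<longrightarrow> label x i = 0)"
    proof (intro allI impI)
      fix x i assume "\<forall>i<n. x i \<le> p" "i < n" "x i = 0"
      with F[OF pt[of x], of i] p(1) show "label x i = 0"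
        by (simp add: label_def pt_def)
    qed
  qed (use p(1) in \<open>auto simp: label_def\<close>)
  have near: "\<bar>pt r j - pt q j\<bar> \<le> 1 / real p" if "\<forall>j<n. q j \<le> r j \<and> r j \<le> q j + 1" "j < n" for r j
  proof -
    have "real (q j) \<le> real (r j)" "real (r j) \<le> real (q j) + 1"
      using that by (metis of_nat_le_iff, metis of_nat_le_iff of_nat_1 of_nat_add)
    then show ?thesis
      by (simp add: pt_def diff_divide_distrib[symmetric] divide_right_mono)
  qed
  have le: "\<forall>j<n. r j \<le> p" if "\<forall>j<n. q j \<le> r j \<and> r j \<le> q j + 1" for r
    using that q by (metis Suc_eq_plus1 Suc_leI le_trans)
  have q_in: "pt q \<in> rcube n"
    using pt[of q] q by (simp add: less_imp_le)
  have "\<bar>F (pt q) i - pt q i\<bar> < \<eta>" if "i < n" for i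
  proof -
    have F_near: "\<bar>F (pt r) i - F (pt q) i\<bar> < \<eta> / 2" if r: "\<forall>j<n. q j \<le> r j \<and> r j \<le> q j + 1" for r
    proof (rule \<delta>[OF pt[OF le[OF r]] q_in])
      show "\<bar>pt r j - pt q j\<bar> < \<delta>" if "j < n" for j
        using near[OF r that] p(2) by simp
    qed fact
    obtain r s where r: "\<forall>j<n. q j \<le> r j \<and> r j \<le> q j + 1"
      and s: "\<forall>j<n. q j \<le> s j \<and> s j \<le> q j + 1" and "label r i \<noteq> label s i"
      using rs \<open>i < n\<close> by blast
    then consider "label r i = 0" "label s i \<noteq> 0" | "label s i = 0" "label r i \<noteq> 0"
      by (auto simp: label_def split: if_splits)
    \<comment> \<open>The vertex with label 0 bounds \<open>F (pt q) i - pt q i\<close> below by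
      \<open>- \<eta>\<close>, the other one bounds it above by \<open>\<eta>\<close>: half of
      \<open>\<eta>\<close> is spent on moving \<open>F\<close> to \<open>q\<close>, the other half
      on moving the point.\<close>
    then show ?thesis
    proof cases
      case 1
      show ?thesis
        using l0[OF 1(1)] l1[OF 1(2) le[OF s] \<open>i < n\<close>] F_near[OF r] F_near[OF s]
          near[OF r \<open>i < n\<close>] near[OF s \<open>i < n\<close>] p(3) by linarith
    next
      case 2
      show ?thesis
        using l0[OF 2(1)] l1[OF 2(2) le[OF r] \<open>i < n\<close>] F_near[OF r] F_near[OF s]
          near[OF r \<open>i < n\<close>] near[OF s \<open>i < n\<close>] p(3) by linarith
    qed
  qed
  with q_in show ?thesis by blast
qed

text \<open>The retraction \<open>c \<mapsto> c / max 1 (\<Sum>c)\<close> of the cube onto the simplex of subprobability vectors,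
  with the missing mass put on the extra index \<open>n\<close>. It turns a map of the cube, to which Kuhn's lemma
  applies, into one of the simplex.\<close>

definition cube_wt :: "nat \<Rightarrow> (nat \<Rightarrow> real) \<Rightarrow> nat \<Rightarrow> real" where
  "cube_wt n c i = (if i < n then c i / max 1 (\<Sum>j<n. c j) else 1 - (\<Sum>j<n. c j / max 1 (\<Sum>j<n. c j)))"

lemma sum_cube_wt: "(\<Sum>i\<le>n. cube_wt n c i) = 1"
proof -
  have "(\<Sum>i\<le>n. cube_wt n c i) = (\<Sum>i<n. cube_wt n c i) + cube_wt n c n"
    by (metis lessThan_Suc_atMost sum.lessThan_Suc)
  then show ?thesis by (simp add: cube_wt_def)
qed

lemma cube_wt_nonneg:
  assumes "\<And>i. i < n \<Longrightarrow> 0 \<le> c i"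
  shows "0 \<le> cube_wt n c i"
  using assms by (auto simp: cube_wt_def sum_nonneg simp flip: sum_divide_distrib)

lemma cube_wt_Rats:
  assumes "\<And>i. i < n \<Longrightarrow> c i \<in> \<rat>"
  shows "cube_wt n c i \<in> \<rat>"
proof -
  have "(\<Sum>j<n. c j) \<in> \<rat>"
    using assms by (intro Rats_sum) auto
  then have "max 1 (\<Sum>j<n. c j) \<in> \<rat>"
    by (simp add: max_def)
  then show ?thesis
    using assms by (auto simp: cube_wt_def intro!: Rats_divide Rats_diff Rats_sum)
qed

text \<open>The retraction fixes the simplex: the first \<open>n\<close> weights sum to
  \<open>1 - c n\<close>, hence to at most 1, and the normaliser is 1.\<close>

lemma cube_wt_id:
  assumes "(\<Sum>j\<le>n. c j) = 1" "0 \<le> c n" "i \<le> n"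
  shows "cube_wt n c i = c i"
proof -
  have "(\<Sum>j<n. c j) = 1 - c n"
    using assms(1) by (simp flip: lessThan_Suc_atMost)
  then show ?thesis
    using assms by (auto simp: cube_wt_def max_def)
qed

text \<open>The normaliser is at least 1 and changes by at most \<open>n * \<delta>\<close>, so each
  of the first \<open>n\<close> weights changes by at most \<open>(n + 1) * \<delta>\<close>. The
  last weight is 1 minus their sum and costs another factor \<open>n\<close>.\<close>

lemma cube_wt_Lipschitz:
  assumes c: "\<And>i. i < n \<Longrightarrow> 0 \<le> c i" and d: "\<And>i. i < n \<Longrightarrow> 0 \<le> d i"
    and cd: "\<And>i. i < n \<Longrightarrow> \<bar>c i - d i\<bar> \<le> \<delta>" and "\<delta> \<ge> 0"
  shows "\<bar>cube_wt n c i - cube_wt n d i\<bar> \<le> (real n + 1)^2 * \<delta>"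
proof -
  define a b where "a = max 1 (\<Sum>j<n. c j)" and "b = max 1 (\<Sum>j<n. d j)"
  have a: "a \<ge> 1" and b: "b \<ge> 1"
    by (auto simp: a_def b_def)
  have "\<bar>a - b\<bar> \<le> \<bar>(\<Sum>j<n. c j) - (\<Sum>j<n. d j)\<bar>"
    by (auto simp: a_def b_def)
  also have "\<dots> \<le> (\<Sum>j<n. \<bar>c j - d j\<bar>)"
    by (simp add: sum_subtractf[symmetric])
  also have "\<dots> \<le> real n * \<delta>"
    using sum_bounded_above[of "{..<n}" "\<lambda>j. \<bar>c j - d j\<bar>" \<delta>] cd by simp
  finally have ab: "\<bar>a - b\<bar> \<le> real n * \<delta>" .
  have *: "\<bar>c j / a - d j / b\<bar> \<le> (real n + 1) * \<delta>" if "j < n" for j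
  proof -
    have "d j \<le> (\<Sum>j<n. d j)"
      using d that by (intro member_le_sum) auto
    then have db: "d j \<le> b"
      by (simp add: b_def)
    \<comment> \<open>The changes of numerator and of normaliser are separated so that the latter is
      multiplied only by \<open>d j / b\<close>, which is at most 1.\<close>
    have "c j / a - d j / b = (c j - d j) / a + (d j / b) * ((b - a) / a)"
      using a b by (simp add: field_simps)
    also have "\<bar>\<dots>\<bar> \<le> \<bar>c j - d j\<bar> / a + (d j / b) * (\<bar>b - a\<bar> / a)"
      using a b d[OF that] by (intro order_trans[OF abs_triangle_ineq]) (simp add: abs_mult)
    also have "\<dots> \<le> \<bar>c j - d j\<bar> / 1 + 1 * (\<bar>b - a\<bar> / 1)"
      using a b d[OF that] db by (intro add_mono mult_mono divide_left_mono) auto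
    also have "\<dots> \<le> (real n + 1) * \<delta>"
      using ab cd[OF that] by (simp add: algebra_simps abs_minus_commute)
    finally show ?thesis .
  qed
  show ?thesis
  proof (cases "i < n")
    case True
    have "(real n + 1) * \<delta> \<le> (real n + 1)^2 * \<delta>"
      using \<open>\<delta> \<ge> 0\<close> by (intro mult_right_mono) (auto simp: power2_eq_square)
    then show ?thesis
      using *[OF True] True by (simp add: cube_wt_def flip: a_def b_def)
  next
    case False
    then have "\<bar>cube_wt n c i - cube_wt n d i\<bar> = \<bar>\<Sum>j<n. c j / a - d j / b\<bar>"
      by (simp add: cube_wt_def sum_subtractf abs_minus_commute flip: a_def b_def)
    also have "\<dots> \<le> (\<Sum>j<n. \<bar>c j / a - d j / b\<bar>)"
      by (rule sum_abs)
    also have "\<dots> \<le> real n * ((real n + 1) * \<delta>)"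
      using sum_bounded_above[of "{..<n}" "\<lambda>j. \<bar>c j / a - d j / b\<bar>"] * by simp
    also have "\<dots> \<le> (real n + 1)^2 * \<delta>"
      unfolding power2_eq_square mult.assoc using \<open>\<delta> \<ge> 0\<close> by (intro mult_right_mono) auto
    finally show ?thesis .
  qed
qed

section \<open>Rational convex hulls of finitely many points\<close>

text \<open>Kept apart from the seminorm below because hulls do not depend on the sample point,
  whereas the seminorm does.\<close>

locale real_module = module sc
  for sc :: "real \<Rightarrow> 'e \<Rightarrow> 'e::ab_group_add"
begin

definition rhull :: "nat \<Rightarrow> (nat \<Rightarrow> 'e) \<Rightarrow> 'e set" where
  "rhull n x = {(\<Sum>i\<le>n. sc (c i) (x i)) | c. (\<forall>i\<le>n. c i \<in> \<rat> \<and> 0 \<le> c i) \<and> (\<Sum>i\<le>n. c i) = 1}"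

text \<open>Induction on \<open>n\<close>: the last point is split off with its weight
  \<open>?t\<close>, and the other weights are divided by \<open>1 - ?t\<close>, which keeps them
  rational. If \<open>?t = 1\<close>, all the other weights vanish.\<close>

lemma rhull_subset:
  assumes C: "\<And>x y q. x \<in> C \<Longrightarrow> y \<in> C \<Longrightarrow> q \<in> \<rat> \<Longrightarrow> 0 \<le> q \<Longrightarrow> q \<le> 1 \<Longrightarrow> sc q x + sc (1 - q) y \<in> C"
    and "\<And>i. i \<le> n \<Longrightarrow> x i \<in> C"
  shows "rhull n x \<subseteq> C"
proof -
  have "(\<Sum>i\<le>n. sc (c i) (x i)) \<in> C"
    if "\<And>i. i \<le> n \<Longrightarrow> c i \<in> \<rat> \<and> 0 \<le> c i" "(\<Sum>i\<le>n. c i) = 1" for c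
    using that assms(2)
  proof (induction n arbitrary: c)
    case 0
    then show ?case by simp
  next
    case (Suc n)
    let ?t = "c (Suc n)"
    have sum: "(\<Sum>i\<le>n. c i) = 1 - ?t"
      using Suc.prems(2) by simp
    have t: "?t \<in> \<rat>" "0 \<le> ?t"
      using Suc.prems(1)[of "Suc n"] by auto
    have "0 \<le> (\<Sum>i\<le>n. c i)"
      using Suc.prems(1) by (intro sum_nonneg) auto
    with sum have t1: "?t \<le> 1" by simp
    show ?case
    proof (cases "?t = 1")
      case True
      with sum have "(\<Sum>i\<le>n. c i) = 0" by simp
      then have "\<forall>i\<in>{..n}. c i = 0"
        using Suc.prems(1) by (subst (asm) sum_nonneg_eq_0_iff) auto
      then have "(\<Sum>i\<le>n. sc (c i) (x i)) = 0"
        by (intro sum.neutral) auto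
      with True Suc.prems(3)[of "Suc n"] show ?thesis by simp
    next
      case False
      have "(\<Sum>i\<le>n. sc (c i / (1 - ?t)) (x i)) \<in> C"
        using Suc.prems t t1 False sum
        by (intro Suc.IH) (auto intro!: Rats_divide simp flip: sum_divide_distrib)
      from C[OF Suc.prems(3)[of "Suc n"] this t t1]
      have "sc ?t (x (Suc n)) + sc (1 - ?t) (\<Sum>i\<le>n. sc (c i / (1 - ?t)) (x i)) \<in> C"
        by simp
      also have "sc (1 - ?t) (\<Sum>i\<le>n. sc (c i / (1 - ?t)) (x i)) = (\<Sum>i\<le>n. sc (c i) (x i))"
        unfolding scale_sum_right by (rule sum.cong) (use False in auto)
      finally show ?thesis
        by (simp add: add.commute)
    qed
  qed
  then show ?thesis
    by (auto simp: rhull_def)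
qed

text \<open>A parametrisation of \<open>rhull n x\<close> by the rational cube: its values on the
  cube lie in the hull (\<open>cube_pt_in_rhull\<close>) and exhaust it
  (\<open>rhull_pt\<close>).\<close>

definition cube_pt :: "nat \<Rightarrow> (nat \<Rightarrow> 'e) \<Rightarrow> (nat \<Rightarrow> real) \<Rightarrow> 'e" where
  "cube_pt n x c = (\<Sum>i\<le>n. sc (cube_wt n c i) (x i))"

lemma cube_pt_in_rhull:
  assumes "c \<in> rcube n"
  shows "cube_pt n x c \<in> rhull n x"
  unfolding rhull_def cube_pt_def using assms
  by (intro CollectI exI[of _ "cube_wt n c"]) (auto simp: rcube_def sum_cube_wt cube_wt_nonneg cube_wt_Rats)

lemma rhull_pt:
  assumes "v \<in> rhull n x"
  obtains c where "c \<in> rcube n" "v = cube_pt n x c"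
proof -
  obtain c where c: "v = (\<Sum>i\<le>n. sc (c i) (x i))" "\<And>i. i \<le> n \<Longrightarrow> c i \<in> \<rat> \<and> 0 \<le> c i" "(\<Sum>i\<le>n. c i) = 1"
    using assms by (auto simp: rhull_def)
  have "c i \<le> 1" if "i < n" for i
    using member_le_sum[of i "{..n}" c] c that by auto
  with c show thesis
    by (intro that[of c]) (auto simp: rcube_def cube_pt_def cube_wt_id)
qed

end

text \<open>Below, \<open>p x\<close> is a representative of the random norm of \<open>x\<close> at a fixed sample point. The seminorm
  laws hold almost everywhere only for countably many instances at a time, hence the countable
  carrier \<open>V\<close> and the rational scalars.\<close>

locale rational_seminorm = real_module sc
  for sc :: "real \<Rightarrow> 'e \<Rightarrow> 'e::ab_group_add" +
  fixes V :: "'e set" and p :: "'e \<Rightarrow> real"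
  assumes V_zero: "0 \<in> V"
    and V_add: "x \<in> V \<Longrightarrow> y \<in> V \<Longrightarrow> x + y \<in> V"
    and V_sc: "q \<in> \<rat> \<Longrightarrow> x \<in> V \<Longrightarrow> sc q x \<in> V"
    and p_add: "x \<in> V \<Longrightarrow> y \<in> V \<Longrightarrow> p (x + y) \<le> p x + p y"
    and p_sc: "q \<in> \<rat> \<Longrightarrow> x \<in> V \<Longrightarrow> p (sc q x) = \<bar>q\<bar> * p x"
begin

lemma V_minus: "x \<in> V \<Longrightarrow> - x \<in> V"
  using V_sc[of "-1" x] by simp

lemma V_diff: "x \<in> V \<Longrightarrow> y \<in> V \<Longrightarrow> x - y \<in> V"
  using V_add[of x "- y"] V_minus by simp

lemma V_sum: "(\<And>i. i \<in> I \<Longrightarrow> f i \<in> V) \<Longrightarrow> sum f I \<in> V"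
  by (induction I rule: infinite_finite_induct) (auto intro: V_zero V_add)

lemma p_zero: "p 0 = 0"
  using p_sc[of 0 0] V_zero by simp

lemma p_minus: "x \<in> V \<Longrightarrow> p (- x) = p x"
  using p_sc[of "-1" x] by simp

lemma p_nonneg: "x \<in> V \<Longrightarrow> 0 \<le> p x"
  using p_add[of x "- x"] V_minus[of x] p_minus[of x] p_zero by simp

lemma p_sum: "(\<And>i. i \<in> I \<Longrightarrow> f i \<in> V) \<Longrightarrow> p (sum f I) \<le> (\<Sum>i\<in>I. p (f i))"
proof (induction I rule: infinite_finite_induct)
  case (insert i I)
  then show ?case
    using p_add[of "f i" "sum f I"] V_sum[of I f] by simp
qed (auto simp: p_zero)

lemma p_commute: "x \<in> V \<Longrightarrow> y \<in> V \<Longrightarrow> p (x - y) = p (y - x)"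
  using p_minus[of "x - y"] V_diff by simp

lemma p_triangle: "x \<in> V \<Longrightarrow> y \<in> V \<Longrightarrow> z \<in> V \<Longrightarrow> p (x - z) \<le> p (x - y) + p (y - z)"
  using p_add[of "x - y" "y - z"] V_diff by simp

lemma p_comb:
  assumes "\<And>i. i \<le> n \<Longrightarrow> c i \<in> \<rat>" "\<And>i. i \<le> n \<Longrightarrow> x i \<in> V"
  shows "p (\<Sum>i\<le>n. sc (c i) (x i)) \<le> (\<Sum>i\<le>n. \<bar>c i\<bar> * p (x i))"
proof -
  have "p (\<Sum>i\<le>n. sc (c i) (x i)) \<le> (\<Sum>i\<le>n. p (sc (c i) (x i)))"
    by (rule p_sum) (use assms V_sc in auto)
  also have "\<dots> = (\<Sum>i\<le>n. \<bar>c i\<bar> * p (x i))"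
    by (rule sum.cong) (use assms p_sc in auto)
  finally show ?thesis .
qed

lemma cube_pt_Lipschitz:
  assumes c: "c \<in> rcube n" and d: "d \<in> rcube n"
    and "\<And>i. i < n \<Longrightarrow> \<bar>c i - d i\<bar> \<le> \<delta>" "\<delta> \<ge> 0" and x: "\<And>i. i \<le> n \<Longrightarrow> x i \<in> V"
  shows "p (cube_pt n x c - cube_pt n x d) \<le> (real n + 1)^2 * (\<Sum>i\<le>n. p (x i)) * \<delta>"
proof -
  have "cube_pt n x c - cube_pt n x d = (\<Sum>i\<le>n. sc (cube_wt n c i - cube_wt n d i) (x i))"
    by (simp add: cube_pt_def sum_subtractf scale_left_diff_distrib)
  also have "p \<dots> \<le> (\<Sum>i\<le>n. \<bar>cube_wt n c i - cube_wt n d i\<bar> * p (x i))"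
    using c d x by (intro p_comb Rats_diff cube_wt_Rats) (auto simp: rcube_def)
  also have "\<dots> \<le> (\<Sum>i\<le>n. ((real n + 1)^2 * \<delta>) * p (x i))"
    using assms by (intro sum_mono mult_right_mono cube_wt_Lipschitz p_nonneg) (auto simp: rcube_def)
  also have "\<dots> = (real n + 1)^2 * (\<Sum>i\<le>n. p (x i)) * \<delta>"
    by (simp flip: sum_distrib_left)
  finally show ?thesis .
qed

text \<open>The points of the hull over a grid of mesh \<open>1 / N\<close> in the cube form the
  net, by the Lipschitz bound for \<open>cube_pt\<close>.\<close>

lemma rhull_totally_bounded:
  assumes x: "\<And>i. i \<le> n \<Longrightarrow> x i \<in> V" and "e > 0"
  shows "\<exists>F. finite F \<and> F \<subseteq> rhull n x \<and> (\<forall>v\<in>rhull n x. \<exists>u\<in>F. p (v - u) < e)"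
proof -
  define B where "B = (real n + 1)^2 * (\<Sum>i\<le>n. p (x i))"
  have B: "B \<ge> 0"
    unfolding B_def using x by (intro mult_nonneg_nonneg sum_nonneg p_nonneg) auto
  \<comment> \<open>\<open>B\<close> may be 0, hence the denominator \<open>B + 1\<close>.\<close>
  obtain k where k: "1 / real (Suc k) < e / (B + 1)"
    using nat_approx_posE[of "e / (B + 1)"] B \<open>e > 0\<close> by auto
  define N where "N = Suc k"
  define grid where "grid = (\<lambda>f i. if i < n then real (f i) / real N else 0) ` (PiE {..<n} (\<lambda>_. {..N}))"
  have "finite grid"
    unfolding grid_def by (intro finite_imageI finite_PiE) auto
  moreover have grid: "grid \<subseteq> rcube n"
    by (auto simp: grid_def rcube_def N_def PiE_def Pi_def)
  moreover have "\<exists>u\<in>cube_pt n x ` grid. p (v - u) < e" if v: "v \<in> rhull n x" for v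
  proof -
    obtain c where c: "c \<in> rcube n" "v = cube_pt n x c"
      using v by (rule rhull_pt)
    define f where "f = (\<lambda>i\<in>{..<n}. nat \<lfloor>c i * real N\<rfloor>)"
    define d where "d = (\<lambda>i. if i < n then real (f i) / real N else 0)"
    have f: "f i \<le> N \<and> real (f i) \<le> c i * real N \<and> c i * real N < real (f i) + 1" if "i < n" for i
    proof -
      have "0 \<le> c i" "c i \<le> 1" using c that by (auto simp: rcube_def)
      then have cN: "0 \<le> c i * real N" "c i * real N \<le> real N"
        by (auto simp: mult_left_le_one_le)
      define z where "z = \<lfloor>c i * real N\<rfloor>"
      have z: "0 \<le> z" "real_of_int z \<le> c i * real N" "c i * real N < real_of_int z + 1"
        using cN by (auto simp: z_def)
      then have "real (nat z) = real_of_int z" by simp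
      moreover have "f i = nat z"
        using that by (simp add: f_def z_def)
      ultimately show ?thesis
        using z cN by simp
    qed
    have "f \<in> extensional {..<n}"
      by (simp add: f_def)
    then have "f \<in> PiE {..<n} (\<lambda>_. {..N})"
      using f by (simp add: PiE_iff)
    then have "d \<in> grid"
      unfolding grid_def d_def by (rule imageI)
    have "\<bar>c i - d i\<bar> \<le> 1 / real N" if "i < n" for i
    proof -
      have "c i - d i = (c i * real N - real (f i)) / real N"
        using that by (simp add: d_def N_def field_simps)
      then show ?thesis
        using f[OF that] by (simp add: abs_le_iff divide_right_mono)
    qed
    then have "p (v - cube_pt n x d) \<le> B * (1 / real N)"
      unfolding c(2) B_def using x c(1) \<open>d \<in> grid\<close> grid by (intro cube_pt_Lipschitz) auto
    also have "\<dots> < e"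
      using k B \<open>e > 0\<close> unfolding N_def[symmetric] by (simp add: field_simps N_def)
    finally show ?thesis
      using \<open>d \<in> grid\<close> by blast
  qed
  ultimately show ?thesis
    using cube_pt_in_rhull by (intro exI[of _ "cube_pt n x ` grid"]) auto
qed

text \<open>Schauder's projection: values of \<open>R\<close> are approximated by convex
  combinations of a finite net \<open>x i\<close>, with weights \<open>w\<close>. Sending a cube
  point \<open>c\<close> to the weights of \<open>R (cube_pt n x c)\<close> is a uniformly
  continuous self-map of the cube, and a nearly fixed \<open>c\<close> of it gives a point
  \<open>cube_pt n x c\<close> that \<open>R\<close> nearly fixes.\<close>

lemma schauder_approx:
  assumes C: "C \<subseteq> V" "C \<noteq> {}"
    and conv: "\<And>x y q. x \<in> C \<Longrightarrow> y \<in> C \<Longrightarrow> q \<in> \<rat> \<Longrightarrow> 0 \<le> q \<Longrightarrow> q \<le> 1 \<Longrightarrow> sc q x + sc (1 - q) y \<in> C"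
    and R: "\<And>x. x \<in> C \<Longrightarrow> R x \<in> C"
    and tb: "\<And>e. e > 0 \<Longrightarrow> \<exists>F. finite F \<and> F \<subseteq> C \<and> (\<forall>x\<in>C. \<exists>y\<in>F. p (R x - R y) < e)"
    and uc: "\<And>xs n \<eta>. set xs \<subseteq> C \<Longrightarrow> length xs = Suc n \<Longrightarrow> \<eta> > 0 \<Longrightarrow>
      \<exists>\<delta>>0. \<forall>u\<in>rhull n ((!) xs). \<forall>v\<in>rhull n ((!) xs). p (u - v) < \<delta> \<longrightarrow> p (R u - R v) < \<eta>"
    and "e > 0"
  shows "\<exists>x\<in>C. p (x - R x) < e"
proof -
  \<comment> \<open>Two errors of size \<open>\<epsilon>\<close> will occur, one from the projection
    and one from the nearly fixed point; a third of \<open>e\<close> keeps the final inequality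
    strict.\<close>
  define \<epsilon> where "\<epsilon> = e / 3"
  have \<epsilon>: "\<epsilon> > 0"
    using \<open>e > 0\<close> by (simp add: \<epsilon>_def)
  obtain F where F: "finite F" "F \<subseteq> C" "\<And>x. x \<in> C \<Longrightarrow> \<exists>y\<in>F. p (R x - R y) < \<epsilon> / 2"
    using tb[of "\<epsilon>/2"] \<epsilon> by (meson half_gt_zero)
  obtain ys where ys: "set ys = F"
    using F(1) finite_list by blast
  obtain n where n: "length ys = Suc n"
    using F(3) C(2) ys by (cases "length ys") auto
  \<comment> \<open>The net consists of values of \<open>R\<close>, so its hull stays in
    \<open>C\<close>. It is a list because \<open>uc\<close> speaks of lists, of which a countable
    set has only countably many.\<close>
  define xs where "xs = map R ys"
  define x where "x = (!) xs"
  have len: "length xs = Suc n"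
    by (simp add: xs_def n)
  have xsC: "set xs \<subseteq> C"
    using F(2) R ys by (auto simp: xs_def)
  have xC: "x i \<in> C" if "i \<le> n" for i
    using that xsC len nth_mem[of i xs] by (auto simp: x_def)
  have xV: "x i \<in> V" if "i \<le> n" for i
    using xC[OF that] C(1) by blast
  have net: "\<exists>i\<le>n. p (R y - x i) < \<epsilon> / 2" if "y \<in> C" for y
  proof -
    obtain z where "z \<in> F" "p (R y - R z) < \<epsilon> / 2"
      using F(3)[OF \<open>y \<in> C\<close>] by blast
    moreover from this obtain i where "i < length ys" "z = ys ! i"
      using ys by (metis in_set_conv_nth)
    ultimately show ?thesis
      using n by (intro exI[of _ i]) (auto simp: x_def xs_def)
  qed
  have hullC: "rhull n x \<subseteq> C"
    by (rule rhull_subset[OF conv xC])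
  define K where "K = (real n + 1)^2"
  have K: "K \<ge> 1"
    unfolding K_def by (rule one_le_power) simp
  define P where "P = (\<Sum>i\<le>n. p (x i))"
  have P: "P \<ge> 0"
    unfolding P_def by (intro sum_nonneg p_nonneg xV) auto
  have pP: "p (x i) \<le> P" if "i \<le> n" for i
    unfolding P_def by (rule member_le_sum) (use that p_nonneg xV in auto)

  \<comment> \<open>A partition of unity: \<open>\<mu> y i\<close> vanishes unless
    \<open>x i\<close> is within \<open>\<epsilon>\<close> of \<open>y\<close>. As the net is
    \<open>\<epsilon> / 2\<close>-dense in the image of \<open>R\<close>, the sum \<open>s\<close>
    is at least \<open>\<epsilon> / 2\<close> there, which makes the quotients \<open>w\<close>
    Lipschitz.\<close>
  define \<mu> where "\<mu> y i = max 0 (\<epsilon> - p (y - x i))" for y i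
  define s where "s y = (\<Sum>i\<le>n. \<mu> y i)" for y
  define w where "w y i = \<mu> y i / s y" for y i
  have \<mu>0: "0 \<le> \<mu> y i" for y i
    by (simp add: \<mu>_def)
  have s: "\<epsilon> / 2 \<le> s (R y)" if "y \<in> C" for y
  proof -
    obtain i where i: "i \<le> n" "p (R y - x i) < \<epsilon> / 2"
      using net[OF \<open>y \<in> C\<close>] by blast
    then have "\<epsilon> / 2 \<le> \<mu> (R y) i"
      unfolding \<mu>_def by linarith
    also have "\<dots> \<le> s (R y)"
      unfolding s_def by (rule member_le_sum) (use i \<mu>0 in auto)
    finally show ?thesis .
  qed
  have s_pos: "0 < s (R y)" if "y \<in> C" for y
    using s[OF that] \<epsilon> by simp
  have w0: "0 \<le> w (R y) i" if "y \<in> C" for y i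
    using s_pos[OF that] \<mu>0 by (simp add: w_def)
  have w_sum: "(\<Sum>i\<le>n. w (R y) i) = 1" if "y \<in> C" for y
    using s_pos[OF that] by (simp add: w_def s_def flip: sum_divide_distrib)
  have w1: "w (R y) i \<le> 1" if "y \<in> C" "i \<le> n" for y i
    using member_le_sum[of i "{..n}" "w (R y)"] w0 w_sum that by auto
  have w_cont: "\<bar>w (R y) i - w (R z) i\<bar> \<le> (real n + 2) * \<Delta> / (\<epsilon> / 2)"
    if y: "y \<in> C" and z: "z \<in> C" and "i \<le> n" and le: "p (R y - R z) \<le> \<Delta>" for y z i \<Delta>
  proof -
    have RV: "R y \<in> V" "R z \<in> V"
      using R y z C(1) by auto
    have \<mu>: "\<bar>\<mu> (R y) j - \<mu> (R z) j\<bar> \<le> \<Delta>" if "j \<le> n" for j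
      using p_triangle[of "R y" "R z" "x j"] p_triangle[of "R z" "R y" "x j"] p_commute[of "R y" "R z"]
        RV xV[OF that] le unfolding \<mu>_def by auto
    have "\<bar>s (R y) - s (R z)\<bar> \<le> (\<Sum>j\<le>n. \<bar>\<mu> (R y) j - \<mu> (R z) j\<bar>)"
      unfolding s_def by (simp add: sum_subtractf[symmetric])
    also have "\<dots> \<le> (real n + 1) * \<Delta>"
      using sum_bounded_above[of "{..n}" "\<lambda>j. \<bar>\<mu> (R y) j - \<mu> (R z) j\<bar>" \<Delta>] \<mu> by (simp add: algebra_simps)
    finally have ss: "\<bar>s (R z) - s (R y)\<bar> \<le> (real n + 1) * \<Delta>"
      by (simp add: abs_minus_commute)
    have "w (R y) i - w (R z) i =
        (\<mu> (R y) i - \<mu> (R z) i) / s (R y) + w (R z) i * ((s (R z) - s (R y)) / s (R y))"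
      using s_pos[OF y] s_pos[OF z] by (simp add: w_def field_simps)
    also have "\<bar>\<dots>\<bar> \<le> \<bar>\<mu> (R y) i - \<mu> (R z) i\<bar> / s (R y) + w (R z) i * (\<bar>s (R z) - s (R y)\<bar> / s (R y))"
      using s_pos[OF y] w0[OF z, of i] by (intro order_trans[OF abs_triangle_ineq]) (simp add: abs_mult)
    also have "\<dots> \<le> \<Delta> / (\<epsilon> / 2) + 1 * ((real n + 1) * \<Delta> / (\<epsilon> / 2))"
      using \<mu>[OF \<open>i \<le> n\<close>] ss s[OF y] s_pos[OF y] w0[OF z] w1[OF z \<open>i \<le> n\<close>] \<epsilon>
      by (intro add_mono mult_mono frac_le) auto
    also have "\<dots> = (real n + 2) * \<Delta> / (\<epsilon> / 2)"
      by (simp add: add_divide_distrib algebra_simps)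
    finally show ?thesis .
  qed
  have cubeC: "cube_pt n x c \<in> C" if "c \<in> rcube n" for c
    using cube_pt_in_rhull[OF that] hullC by blast

  define f where "f c = w (R (cube_pt n x c))" for c
  define B where "B = 2 * P + \<epsilon>"
  have B: "B > 0"
    using P \<epsilon> by (simp add: B_def)
  \<comment> \<open>\<open>K\<close> is the Lipschitz constant of \<open>cube_wt\<close> and
    \<open>B\<close> will bound \<open>p (x i - y)\<close>; with this \<open>\<eta>\<close> the
    \<open>n + 1\<close> error terms \<open>K * \<eta> * B\<close> add up to
    \<open>\<epsilon>\<close>.\<close>
  define \<eta> where "\<eta> = \<epsilon> / (K * B * (real n + 1))"
  have \<eta>: "\<eta> > 0"
    using \<epsilon> B K by (simp add: \<eta>_def)
  have "\<exists>c\<in>rcube n. \<forall>i<n. \<bar>f c i - c i\<bar> < \<eta>"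
  proof (rule brouwer_rcube)
    fix c i assume "c \<in> rcube n" "i < n"
    then show "0 \<le> f c i \<and> f c i \<le> 1"
      using w0[OF cubeC] w1[OF cubeC] by (simp add: f_def)
  next
    fix \<gamma> :: real assume "\<gamma> > 0"
    \<comment> \<open>Solves for the bound in \<open>w_cont\<close> to be
      \<open>\<gamma> / 2\<close>.\<close>
    define \<Delta> where "\<Delta> = \<gamma> / 2 * (\<epsilon> / 2) / (real n + 2)"
    have "\<Delta> > 0"
      using \<open>\<gamma> > 0\<close> \<epsilon> by (simp add: \<Delta>_def)
    then obtain \<delta>' where \<delta>': "\<delta>' > 0"
      "\<And>u v. u \<in> rhull n x \<Longrightarrow> v \<in> rhull n x \<Longrightarrow> p (u - v) < \<delta>' \<Longrightarrow> p (R u - R v) < \<Delta>"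
      using uc[OF xsC len, of \<Delta>] unfolding x_def by blast
    define \<delta> where "\<delta> = \<delta>' / (K * P + 1)"
    have KP: "K * P \<ge> 0"
      using K P by simp
    have \<delta>: "\<delta> > 0"
      using \<delta>'(1) KP by (simp add: \<delta>_def)
    have "\<bar>f c i - f d i\<bar> < \<gamma>"
      if c: "c \<in> rcube n" and d: "d \<in> rcube n" and "i < n" and cd: "\<And>i. i < n \<Longrightarrow> \<bar>c i - d i\<bar> < \<delta>" for c d i
    proof -
      have "p (cube_pt n x c - cube_pt n x d) \<le> K * P * \<delta>"
        unfolding K_def P_def by (rule cube_pt_Lipschitz[OF c d _ _ xV]) (use cd \<delta> in \<open>auto simp: less_imp_le\<close>)
      also have "\<dots> < \<delta>'"
        using \<delta>'(1) KP by (simp add: \<delta>_def field_simps)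
      finally have "p (R (cube_pt n x c) - R (cube_pt n x d)) \<le> \<Delta>"
        using \<delta>'(2)[OF cube_pt_in_rhull[OF c] cube_pt_in_rhull[OF d]] by simp
      then have "\<bar>f c i - f d i\<bar> \<le> (real n + 2) * \<Delta> / (\<epsilon> / 2)"
        unfolding f_def using \<open>i < n\<close> by (intro w_cont cubeC c d) auto
      also have "\<dots> = \<gamma> / 2"
      proof -
        have "N * (\<gamma> / 2 * (\<epsilon> / 2) / N) / (\<epsilon> / 2) = \<gamma> / 2" if "N \<noteq> 0" for N :: real
          using that \<epsilon> by simp
        from this[of "real n + 2"] show ?thesis
          by (simp only: \<Delta>_def)
      qed
      finally show ?thesis
        using \<open>\<gamma> > 0\<close> by simp
    qed
    with \<delta> show "\<exists>\<delta>>0. \<forall>c\<in>rcube n. \<forall>d\<in>rcube n.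
      (\<forall>i<n. \<bar>c i - d i\<bar> < \<delta>) \<longrightarrow> (\<forall>i<n. \<bar>f c i - f d i\<bar> < \<gamma>)"
      by (intro exI[of _ \<delta>]) auto
  qed fact
  then obtain c where c: "c \<in> rcube n" and near_fix: "\<And>i. i < n \<Longrightarrow> \<bar>f c i - c i\<bar> < \<eta>"
    by blast
  define v where "v = cube_pt n x c"
  have v: "v \<in> C"
    using cubeC[OF c] by (simp add: v_def)
  define y where "y = R v"
  have y: "y \<in> C" "y \<in> V"
    using R[OF v] C(1) by (auto simp: y_def)
  have f: "f c i = w y i" for i
    by (simp add: f_def y_def v_def)
  have w_y: "0 \<le> w y i" "(\<Sum>i\<le>n. w y i) = 1" for i
    using w0[OF v] w_sum[OF v] by (auto simp: y_def)
  \<comment> \<open>The retraction fixes the weight vector \<open>w y\<close>, so its Lipschitz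
    bound carries the closeness of \<open>c\<close> and \<open>w y\<close> from the indices below
    \<open>n\<close> to all weights, including the last.\<close>
  have cube_wt_w: "\<bar>cube_wt n c i - w y i\<bar> \<le> K * \<eta>" if "i \<le> n" for i
  proof -
    have "\<bar>cube_wt n c i - cube_wt n (w y) i\<bar> \<le> K * \<eta>"
      unfolding K_def
    proof (rule cube_wt_Lipschitz)
      show "\<bar>c j - w y j\<bar> \<le> \<eta>" if "j < n" for j
        using near_fix[OF that] by (simp add: f abs_minus_commute)
    qed (use c w_y \<eta> in \<open>auto simp: rcube_def\<close>)
    then show ?thesis
      using cube_wt_id[of "w y" n i] w_y that by simp
  qed
  have bd: "p (x i - y) \<le> B" if "i \<le> n" for i
  proof -
    obtain j where j: "j \<le> n" "p (y - x j) < \<epsilon> / 2"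
      using net[OF v] by (auto simp: y_def)
    have "p (x i - y) \<le> p (x i) + p (x j) + p (y - x j)"
      using p_triangle[of "x i" "x j" y] p_add[of "x i" "- x j"] p_minus[of "x j"] p_commute[of "x j" y]
        V_minus[OF xV[OF j(1)]] xV[OF j(1)] xV[OF that] y(2) by simp
    then show ?thesis
      using pP[OF that] pP[OF j(1)] j(2) \<epsilon> by (simp add: B_def)
  qed
  \<comment> \<open>A positive weight occurs only at net points within \<open>\<epsilon>\<close> of
    \<open>y\<close>; for weight 0 both sides vanish.\<close>
  have near: "w y i * p (x i - y) \<le> w y i * \<epsilon>" if "i \<le> n" for i
  proof (cases "w y i = 0")
    case False
    then have "p (y - x i) < \<epsilon>"
      by (auto simp: w_def \<mu>_def max_def split: if_splits)
    then show ?thesis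
      using w_y p_commute[of y "x i"] xV[OF that] y by (intro mult_left_mono) auto
  qed simp
  \<comment> \<open>The weights sum to 1, so \<open>y\<close> can be moved under the sum.\<close>
  have "v - y = (\<Sum>i\<le>n. sc (cube_wt n c i) (x i - y))"
    by (simp add: scale_right_diff_distrib sum_subtractf v_def cube_pt_def sum_cube_wt flip: scale_sum_left)
  also have "p \<dots> \<le> (\<Sum>i\<le>n. \<bar>cube_wt n c i\<bar> * p (x i - y))"
    by (rule p_comb) (use c xV y V_diff in \<open>auto simp: rcube_def intro!: cube_wt_Rats\<close>)
  also have "\<dots> \<le> (\<Sum>i\<le>n. w y i * \<epsilon> + K * \<eta> * B)"
  proof (rule sum_mono)
    fix i assume "i \<in> {..n}"
    then have i: "i \<le> n" by simp
    have p0: "0 \<le> p (x i - y)"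
      using xV[OF i] y by (intro p_nonneg V_diff)
    have "\<bar>cube_wt n c i\<bar> * p (x i - y) \<le> (w y i + K * \<eta>) * p (x i - y)"
      using cube_wt_w[OF i] w_y(1)[of i] p0 by (intro mult_right_mono) auto
    also have "\<dots> \<le> w y i * \<epsilon> + K * \<eta> * B"
      unfolding distrib_right using K \<eta> by (intro add_mono[OF near[OF i]] mult_left_mono bd[OF i]) auto
    finally show "\<bar>cube_wt n c i\<bar> * p (x i - y) \<le> w y i * \<epsilon> + K * \<eta> * B" .
  qed
  also have "\<dots> = \<epsilon> + (real n + 1) * (K * \<eta> * B)"
    by (simp add: sum.distrib w_y flip: sum_distrib_right)
  also have "(real n + 1) * (K * \<eta> * B) = \<epsilon>"
    using K B by (simp add: \<eta>_def)
  finally have "p (v - y) \<le> \<epsilon> + \<epsilon>" .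
  also have "\<dots> < e"
    using \<open>e > 0\<close> by (simp add: \<epsilon>_def)
  finally show ?thesis
    using v by (auto simp: y_def)
qed

end


section \<open>Almost sure convergence in RN modules\<close>

lemma AE_countable_pairs:
  assumes "countable A" "countable B" "\<And>x y. x \<in> A \<Longrightarrow> y \<in> B \<Longrightarrow> AE w in M. P x y w"
  shows "AE w in M. \<forall>x\<in>A. \<forall>y\<in>B. P x y w"
  using assms by (simp add: AE_ball_countable)

lemma L0_le_class:
  assumes [measurable]: "f \<in> borel_measurable M" "g \<in> borel_measurable M"
  shows "L0_le M (L0_class M f) (L0_class M g) \<longleftrightarrow> (AE w in M. f w \<le> g w)"
proof
  assume "L0_le M (L0_class M f) (L0_class M g)"
  then obtain f' g' where "AE w in M. f w = f' w" "AE w in M. g w = g' w" "AE w in M. f' w \<le> g' w"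
    by (auto simp: L0_le_def mem_L0_class)
  then show "AE w in M. f w \<le> g w" by eventually_elim simp
next
  assume "AE w in M. f w \<le> g w"
  then show "L0_le M (L0_class M f) (L0_class M g)"
    unfolding L0_le_def by (intro bexI[of _ f] bexI[of _ g]) (auto simp: L0_class_self)
qed

section \<open>Representatives of the random norm\<close>

context rn_module
begin

text \<open>One representative per element, by choice. Each law of the norm then fails on a null set
  that depends on the elements involved.\<close>

definition nrm :: "'e \<Rightarrow> 'w \<Rightarrow> real" where
  "nrm x = (SOME f. f \<in> rnorm x)"

definition sc :: "real \<Rightarrow> 'e \<Rightarrow> 'e" where
  "sc r = smul (L0_const M (of_real r))"

lemma nrm_mem: "nrm x \<in> rnorm x"
proof -
  obtain f where "f \<in> rnorm x" by (rule rnorm_rep)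
  then show ?thesis unfolding nrm_def by (rule someI[of "\<lambda>f. f \<in> rnorm x"])
qed

lemma nrm_measurable [measurable]: "nrm x \<in> borel_measurable M"
  by (rule rnorm_rep_measurable[OF nrm_mem])

lemma rnorm_eq_nrm: "rnorm x = L0_class M (nrm x)"
  by (rule rnorm_eq_class[OF nrm_mem])

lemma nrm_nonneg: "AE w in M. 0 \<le> nrm x w"
  using rnorm_in[of x] by (simp add: rnorm_eq_nrm L0_plus_def L0_le_class)

lemma nrm_add: "AE w in M. nrm (x + y) w \<le> nrm x w + nrm y w"
proof -
  have "L0_add M (rnorm x) (rnorm y) = L0_class M (\<lambda>w. nrm x w + nrm y w)"
    by (simp only: rnorm_eq_nrm) (subst L0_map2_class, auto)
  then show ?thesis
    using rnorm_triangle[of x y] by (simp add: rnorm_eq_nrm L0_le_class)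
qed

lemma nrm_smul:
  fixes f :: "'w \<Rightarrow> 'k"
  assumes [measurable]: "f \<in> borel_measurable M"
  shows "AE w in M. nrm (smul (L0_class M f) x) w = norm (f w) * nrm x w"
proof -
  have 1: "L0_abs M (L0_class M f) = L0_class M (\<lambda>w. norm (f w))"
    by (subst L0_map_class) auto
  have 2: "L0_mult M (L0_class M (\<lambda>w. norm (f w))) (L0_class M (nrm x)) = L0_class M (\<lambda>w. norm (f w) * nrm x w)"
    by (subst L0_map2_class) auto
  have "L0_class M (nrm (smul (L0_class M f) x)) = L0_class M (\<lambda>w. norm (f w) * nrm x w)"
    using rnorm_smul[OF L0_class_in[OF assms], of x] by (simp only: rnorm_eq_nrm 1 2)
  then show ?thesis
    by (subst (asm) L0_class_eq_iff) auto
qed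

lemma nrm_eq_0_imp:
  assumes "AE w in M. nrm x w = 0"
  shows "x = 0"
proof (rule rnorm_eq_zero)
  show "rnorm x = L0_const M 0"
    using assms by (simp add: rnorm_eq_nrm L0_class_eq_iff)
qed

lemma nrm_zero: "AE w in M. nrm 0 w = 0"
  using rnorm_zero by (simp add: rnorm_eq_nrm L0_class_eq_iff)

sublocale sc: real_module sc
proof
  fix a b :: real and x y :: 'e
  have c: "L0_const M c \<in> L0 M" for c :: 'k by (simp add: L0_class_in)
  show "sc a (x + y) = sc a x + sc a y"
    unfolding sc_def by (rule smul_add_right[OF c])
  show "sc (a + b) x = sc a x + sc b x"
    unfolding sc_def by (subst smul_add_left[OF c c, symmetric]) (subst L0_map2_class, auto)
  show "sc a (sc b x) = sc (a * b) x"
    unfolding sc_def by (subst smul_mult[OF c c, symmetric]) (subst L0_map2_class, auto)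
  show "sc 1 x = x"
    unfolding sc_def using smul_one by simp
qed

lemma nrm_sc: "AE w in M. nrm (sc r x) w = \<bar>r\<bar> * nrm x w"
  using nrm_smul[of "\<lambda>_. of_real r" x] by (simp add: sc_def)

lemma nrm_uminus: "AE w in M. nrm (- x) w = nrm x w"
  using nrm_sc[of "-1" x] by simp

section \<open>Pointwise pseudometrics\<close>

definition dist_at :: "'w \<Rightarrow> 'e \<Rightarrow> 'e \<Rightarrow> real" where
  "dist_at w x y = nrm (x - y) w"

lemma dist_at_measurable [measurable]: "(\<lambda>w. dist_at w x y) \<in> borel_measurable M"
  unfolding dist_at_def by measurable

text \<open>Relative to a set \<open>W\<close> because the laws hold outside a common null set only
  when there are countably many of them, as in \<open>AE_pmet_on\<close>.\<close>

definition pmet_on :: "'e set \<Rightarrow> 'w \<Rightarrow> bool" where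
  "pmet_on W w \<longleftrightarrow> (\<forall>x\<in>W. \<forall>y\<in>W. 0 \<le> dist_at w x y \<and> dist_at w x x = 0 \<and>
     dist_at w x y = dist_at w y x \<and> (\<forall>z\<in>W. dist_at w x z \<le> dist_at w x y + dist_at w y z))"

lemma pmet_onD:
  assumes "pmet_on W w" "x \<in> W" "y \<in> W"
  shows "0 \<le> dist_at w x y" "dist_at w x x = 0" "dist_at w x y = dist_at w y x"
    "z \<in> W \<Longrightarrow> dist_at w x z \<le> dist_at w x y + dist_at w y z"
  using assms unfolding pmet_on_def by blast+

lemma AE_pmet_on:
  assumes "countable W"
  shows "AE w in M. pmet_on W w"
proof -
  have "AE w in M. 0 \<le> dist_at w x y \<and> dist_at w x x = 0 \<and> dist_at w x y = dist_at w y x \<and>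
     (\<forall>z\<in>W. dist_at w x z \<le> dist_at w x y + dist_at w y z)" for x y
  proof -
    have "AE w in M. dist_at w x z \<le> dist_at w x y + dist_at w y z" for z
      using nrm_add[of "x - y" "y - z"] by (simp add: dist_at_def)
    then have "AE w in M. \<forall>z\<in>W. dist_at w x z \<le> dist_at w x y + dist_at w y z"
      using assms by (simp add: AE_ball_countable)
    with nrm_nonneg[of "x - y"] nrm_zero nrm_uminus[of "x - y"] show ?thesis
      by eventually_elim (simp add: dist_at_def)
  qed
  then show ?thesis
    unfolding pmet_on_def using assms by (simp add: AE_ball_countable)
qed

lemma dist_at_eq_0_imp: "AE w in M. dist_at w x y = 0 \<Longrightarrow> x = y"
  using nrm_eq_0_imp[of "x - y"] by (simp add: dist_at_def)

section \<open>Convergence in probability against almost sure convergence\<close>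

lemma el_nbhd_nrm: "x \<in> el_nbhd M rnorm \<epsilon> \<delta> \<longleftrightarrow> prob {w \<in> space M. nrm x w < \<epsilon>} > 1 - \<delta>"
proof
  assume "x \<in> el_nbhd M rnorm \<epsilon> \<delta>"
  then obtain f where f: "f \<in> rnorm x" "prob {w \<in> space M. f w < \<epsilon>} > 1 - \<delta>"
    by (auto simp: el_nbhd_def)
  have [measurable]: "f \<in> borel_measurable M" and eq: "AE w in M. nrm x w = f w"
    using f(1) by (simp_all add: rnorm_eq_nrm mem_L0_class)
  have "prob {w \<in> space M. f w < \<epsilon>} = prob {w \<in> space M. nrm x w < \<epsilon>}"
    by (rule finite_measure_eq_AE) (use eq in auto)
  with f show "prob {w \<in> space M. nrm x w < \<epsilon>} > 1 - \<delta>" by simp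
qed (use nrm_mem in \<open>auto simp: el_nbhd_def\<close>)

text \<open>Continuity of the probability along increasing events. It turns an index depending on
  \<open>w\<close> into a single one that is good with probability near 1.\<close>

lemma prob_close_1:
  assumes [measurable]: "\<And>n. Measurable.pred M (P n)"
    and mono: "\<And>n w. P n w \<Longrightarrow> P (Suc n) w"
    and ae: "AE w in M. \<exists>n. P n w" and "\<delta> > 0"
  shows "\<exists>n. prob {w \<in> space M. P n w} > 1 - \<delta>"
proof -
  have "(\<lambda>n. prob {w \<in> space M. P n w}) \<longlonglongrightarrow> prob (\<Union>n. {w \<in> space M. P n w})"
    by (intro finite_Lim_measure_incseq incseq_SucI) (auto intro: mono)
  also have "prob (\<Union>n. {w \<in> space M. P n w}) = 1"
    by (subst prob_eq_1) (use ae in auto)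
  finally have "\<forall>\<^sub>F n in sequentially. prob {w \<in> space M. P n w} > 1 - \<delta>"
    using \<open>\<delta> > 0\<close> by (intro order_tendstoD) auto
  then show ?thesis
    by (auto simp: eventually_sequentially)
qed

text \<open>Almost sure convergence implies convergence in probability: \<open>prob_close_1\<close>
  is applied to the events that all terms from \<open>N\<close> on are close to
  \<open>l\<close>.\<close>

lemma limitin_if_AE:
  assumes "AE w in M. (\<lambda>n. dist_at w (x n) l) \<longlonglongrightarrow> 0"
  shows "limitin (el_topology M rnorm) x l sequentially"
  unfolding limitin_el_topology
proof (intro allI impI, elim conjE)
  fix \<epsilon> \<delta> :: real assume *: "\<epsilon> > 0" "0 < \<delta>"
  have "AE w in M. \<exists>N. \<forall>n\<ge>N. nrm (x n - l) w < \<epsilon>"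
    using assms
  proof eventually_elim
    case (elim w)
    then have "\<forall>\<^sub>F n in sequentially. dist_at w (x n) l < \<epsilon>"
      using * by (intro order_tendstoD)
    then show ?case
      by (auto simp: eventually_sequentially dist_at_def)
  qed
  then obtain N where N: "prob {w \<in> space M. \<forall>n\<ge>N. nrm (x n - l) w < \<epsilon>} > 1 - \<delta>"
    using prob_close_1[of "\<lambda>N w. \<forall>n\<ge>N. nrm (x n - l) w < \<epsilon>" \<delta>] * by auto
  have "x n - l \<in> el_nbhd M rnorm \<epsilon> \<delta>" if "n \<ge> N" for n
  proof -
    have "prob {w \<in> space M. \<forall>n\<ge>N. nrm (x n - l) w < \<epsilon>} \<le> prob {w \<in> space M. nrm (x n - l) w < \<epsilon>}"
      using that by (intro finite_measure_mono) auto
    with N show ?thesis by (simp add: el_nbhd_nrm)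
  qed
  then show "\<forall>\<^sub>F n in sequentially. x n - l \<in> el_nbhd M rnorm \<epsilon> \<delta>"
    by (auto simp: eventually_sequentially)
qed

lemma el_cauchy_if_AE:
  assumes "AE w in M. \<forall>e>0. \<exists>N. \<forall>m\<ge>N. \<forall>n\<ge>N. dist_at w (x m) (x n) < e"
  shows "el_cauchy M rnorm x"
  unfolding el_cauchy_def
proof (intro allI impI, elim conjE)
  fix \<epsilon> \<delta> :: real assume *: "\<epsilon> > 0" "0 < \<delta>"
  have "AE w in M. \<exists>N. \<forall>m\<ge>N. \<forall>n\<ge>N. nrm (x m - x n) w < \<epsilon>"
    using assms by eventually_elim (use * in \<open>auto simp: dist_at_def\<close>)
  then obtain N where N: "prob {w \<in> space M. \<forall>m\<ge>N. \<forall>n\<ge>N. nrm (x m - x n) w < \<epsilon>} > 1 - \<delta>"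
    using prob_close_1[of "\<lambda>N w. \<forall>m\<ge>N. \<forall>n\<ge>N. nrm (x m - x n) w < \<epsilon>" \<delta>] * by auto
  have "x m - x n \<in> el_nbhd M rnorm \<epsilon> \<delta>" if "n \<ge> N" "m \<ge> N" for m n
  proof -
    have "prob {w \<in> space M. \<forall>m\<ge>N. \<forall>n\<ge>N. nrm (x m - x n) w < \<epsilon>} \<le> prob {w \<in> space M. nrm (x m - x n) w < \<epsilon>}"
      using that by (intro finite_measure_mono) auto
    with N show ?thesis by (simp add: el_nbhd_nrm)
  qed
  then show "\<exists>N. \<forall>m\<ge>N. \<forall>n\<ge>N. x m - x n \<in> el_nbhd M rnorm \<epsilon> \<delta>"
    by blast
qed

text \<open>The subsequence is chosen with exceptional probabilities bounded by a geometric series;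
  the Borel-Cantelli lemma does the rest.\<close>

lemma limitin_AE_subseq:
  assumes "limitin (el_topology M rnorm) x l sequentially"
  shows "\<exists>r. strict_mono r \<and> (AE w in M. (\<lambda>n. dist_at w (x (r n)) l) \<longlonglongrightarrow> 0)"
proof -
  let ?P = "\<lambda>n k. prob {w \<in> space M. nrm (x n - l) w < (1/2)^k} > 1 - (1/2)^k"
  \<comment> \<open>The exponent starts at 1, since the second parameter of a neighbourhood must be
    less than 1.\<close>
  have ev: "\<forall>\<^sub>F n in sequentially. ?P n (Suc k)" for k
  proof -
    have "(1/2 :: real)^Suc k < 1"
      by (rule power_Suc_less_one) auto
    moreover have "(1/2 :: real)^Suc k > 0"
      by simp
    ultimately show ?thesis
      using assms unfolding limitin_el_topology el_nbhd_nrm by blast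
  qed
  have "\<exists>r. strict_mono r \<and> (\<forall>k. ?P (r k) (Suc k))"
  proof -
    have "\<exists>n>m. ?P n (Suc k)" for m k
    proof -
      obtain n where "n > m" "?P n (Suc k)"
        using eventually_happens[OF eventually_conj[OF eventually_gt_at_top[of m] ev[of k]]] by auto
      then show ?thesis by blast
    qed
    then obtain s where s: "\<And>m k. s m k > m" "\<And>m k. ?P (s m k) (Suc k)"
      by metis
    define r where "r = rec_nat (s 0 0) (\<lambda>k m. s m (Suc k))"
    have "r (Suc k) > r k" for k
      by (simp add: r_def s)
    moreover have "?P (r k) (Suc k)" for k
      by (cases k) (simp_all only: r_def nat.rec s)
    ultimately show ?thesis
      by (auto simp: strict_mono_Suc_iff simp del: power_Suc)
  qed
  then obtain r where r: "strict_mono r" "\<And>k. ?P (r k) (Suc k)" by blast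
  define A where "A k = {w \<in> space M. \<not> nrm (x (r k) - l) w < (1/2)^Suc k}" for k
  have A[measurable]: "A k \<in> sets M" for k
    unfolding A_def by measurable
  have le: "prob (A k) \<le> (1/2)^Suc k" for k
    using r(2)[of k] prob_neg[of "\<lambda>w. nrm (x (r k) - l) w < (1/2)^Suc k"]
    by (simp add: A_def del: power_Suc)
  have "summable (\<lambda>k. prob (A k))"
    by (rule summable_comparison_test'[of "\<lambda>k. (1/2)^Suc k" 0])
       (use le in \<open>auto intro!: summable_geometric summable_mult simp: measure_nonneg\<close>)
  then have "AE w in M. \<forall>\<^sub>F k in sequentially. w \<in> space M - A k"
    by (intro borel_cantelli_AE1) (auto simp: emeasure_eq_measure)
  moreover have "AE w in M. \<forall>k. 0 \<le> nrm (x (r k) - l) w"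
    by (simp add: AE_all_countable nrm_nonneg)
  ultimately have "AE w in M. (\<lambda>n. dist_at w (x (r n)) l) \<longlonglongrightarrow> 0"
  proof eventually_elim
    case (elim w)
    show ?case
      unfolding dist_at_def
    proof (rule tendsto_sandwich[OF _ _ tendsto_const])
      show "\<forall>\<^sub>F n in sequentially. nrm (x (r n) - l) w \<le> (1/2)^Suc n"
        using elim(1) by eventually_elim (auto simp: A_def)
      show "(\<lambda>n. (1/2)^Suc n :: real) \<longlonglongrightarrow> 0"
        by (intro LIMSEQ_Suc LIMSEQ_realpow_zero) auto
    qed (use elim in auto)
  qed
  with r show ?thesis by blast
qed

text \<open>Completeness gives only a limit in probability. A subsequence converges to it almost
  surely, and at each such \<open>w\<close> a Cauchy sequence follows its convergent
  subsequence.\<close>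

lemma AE_complete:
  assumes "el_complete M rnorm TYPE('e)"
    and c: "AE w in M. \<forall>e>0. \<exists>N. \<forall>m\<ge>N. \<forall>n\<ge>N. dist_at w (x m) (x n) < e"
  shows "\<exists>l. AE w in M. (\<lambda>n. dist_at w (x n) l) \<longlonglongrightarrow> 0"
proof -
  obtain l where "limitin (el_topology M rnorm) x l sequentially"
    using assms(1) el_cauchy_if_AE[OF c] by (auto simp: el_complete_def)
  then obtain r where r: "strict_mono r" "AE w in M. (\<lambda>n. dist_at w (x (r n)) l) \<longlonglongrightarrow> 0"
    using limitin_AE_subseq by blast
  have "AE w in M. pmet_on (insert l (range x)) w"
    by (intro AE_pmet_on) auto
  with r(2) c have "AE w in M. (\<lambda>n. dist_at w (x n) l) \<longlonglongrightarrow> 0"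
  proof eventually_elim
    case (elim w)
    note pm = pmet_onD[OF elim(3)]
    show ?case
    proof (rule LIMSEQ_I)
      fix e :: real assume "e > 0"
      then obtain N where N: "\<And>m n. m \<ge> N \<Longrightarrow> n \<ge> N \<Longrightarrow> dist_at w (x m) (x n) < e/2"
        using elim(2)[rule_format, of "e/2"] by auto
      obtain K where K: "\<And>k. k \<ge> K \<Longrightarrow> norm (dist_at w (x (r k)) l - 0) < e/2"
        using LIMSEQ_D[OF elim(1), of "e/2"] \<open>e > 0\<close> by auto
      define k where "k = max K N"
      have "r k \<ge> N"
        using seq_suble[OF r(1), of k] by (simp add: k_def)
      have "norm (dist_at w (x n) l - 0) < e" if "n \<ge> N" for n
        using pm(4)[of "x n" "x (r k)" l] pm(1)[of "x n" l] N[OF that \<open>r k \<ge> N\<close>] K[of k]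
        by (simp add: k_def)
      then show "\<exists>N. \<forall>n\<ge>N. norm (dist_at w (x n) l - 0) < e" by blast
    qed
  qed
  then show ?thesis ..
qed

lemma AE_closed:
  assumes "closedin (el_topology M rnorm) G" "\<And>n. x n \<in> G"
    and "AE w in M. (\<lambda>n. dist_at w (x n) l) \<longlonglongrightarrow> 0"
  shows "l \<in> G"
  using limitin_closedin[OF limitin_if_AE[OF assms(3)] assms(1)] assms(2) by simp

section \<open>Gluing along measurable indices\<close>

text \<open>The norm of \<open>smul (L0_ind M A) (x - y)\<close> agrees with that of
  \<open>x - y\<close> on \<open>A\<close> and is 0 elsewhere.\<close>

lemma smul_ind_eq_iff:
  assumes [measurable]: "A \<in> sets M"
  shows "smul (L0_ind M A) x = smul (L0_ind M A) y \<longleftrightarrow> (AE w in M. w \<in> A \<longrightarrow> dist_at w x y = 0)"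
proof -
  have I: "L0_ind M A \<in> (L0 M :: ('w \<Rightarrow> 'k) set set)"
    by (simp add: L0_class_in)
  have "smul (L0_ind M A) ((x - y) + y) = smul (L0_ind M A) (x - y) + smul (L0_ind M A) y"
    by (rule smul_add_right[OF I])
  then have "smul (L0_ind M A) x = smul (L0_ind M A) y \<longleftrightarrow> smul (L0_ind M A) (x - y) = 0"
    by simp
  also have "\<dots> \<longleftrightarrow> (AE w in M. nrm (smul (L0_ind M A) (x - y)) w = 0)"
    using nrm_eq_0_imp nrm_zero by metis
  also have "\<dots> \<longleftrightarrow> (AE w in M. w \<in> A \<longrightarrow> dist_at w x y = 0)"
  proof -
    have "AE w in M. nrm (smul (L0_ind M A) (x - y)) w = 0 \<longleftrightarrow> (w \<in> A \<longrightarrow> dist_at w x y = 0)"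
      using nrm_smul[of "indicator A" "x - y", OF borel_measurable_indicator[OF assms]]
      by eventually_elim (auto simp: dist_at_def split: split_indicator)
    then show ?thesis
      by (rule eventually_subst)
  qed
  finally show ?thesis .
qed


text \<open>Used throughout to replace, at a fixed \<open>w\<close>, a glued element by the piece
  that it coincides with there.\<close>

lemma pmet_on_eq:
  assumes "pmet_on W w" "x \<in> W" "y \<in> W" "z \<in> W" "dist_at w x y = 0"
  shows "dist_at w x z = dist_at w y z" "dist_at w z x = dist_at w z y"
proof -
  note pm = pmet_onD[OF assms(1)]
  show "dist_at w x z = dist_at w y z"
    using pm(4)[of x y z] pm(4)[of y x z] pm(3)[of x y] assms by simp
  then show "dist_at w z x = dist_at w z y"
    using pm(3)[of x z] pm(3)[of y z] assms by simp
qed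

lemma countable_partition_nat:
  assumes [measurable]: "n \<in> measurable M (count_space UNIV)"
  shows "countable_partition M (\<lambda>l::nat. {w \<in> space M. n w = l})"
proof -
  have "{w \<in> space M. n w = l} \<in> sets M" for l
    by measurable
  then show ?thesis
    unfolding countable_partition_def disjoint_family_on_def by blast
qed

text \<open>Stability is applied to the partition into the level sets of \<open>n\<close>; the
  countably many null sets are then united.\<close>

lemma sigma_stable_glue:
  fixes n :: "'w \<Rightarrow> nat"
  assumes H: "sigma_stable M smul H" "\<And>i. g i \<in> H"
    and n[measurable]: "n \<in> measurable M (count_space UNIV)"
  shows "\<exists>y\<in>H. AE w in M. dist_at w y (g (n w)) = 0"
proof -
  have "range g \<subseteq> H" using H(2) by auto
  then obtain y where y: "y \<in> H"
    "\<And>l. smul (L0_ind M {w \<in> space M. n w = l}) y = smul (L0_ind M {w \<in> space M. n w = l}) (g l)"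
    using H(1) countable_partition_nat[OF n] unfolding sigma_stable_def by meson
  have "{w \<in> space M. n w = l} \<in> sets M" for l
    by measurable
  then have "AE w in M. w \<in> {w \<in> space M. n w = l} \<longrightarrow> dist_at w y (g l) = 0" for l
    using y(2)[of l] smul_ind_eq_iff[of "{w \<in> space M. n w = l}" y "g l"] by blast
  then have "AE w in M. \<forall>l. w \<in> {w \<in> space M. n w = l} \<longrightarrow> dist_at w y (g l) = 0"
    by (simp only: AE_all_countable) simp
  then have "AE w in M. dist_at w y (g (n w)) = 0"
    using AE_space by eventually_elim auto
  with y(1) show ?thesis by blast
qed

text \<open>As \<open>conc\<close> is a definite description, the direction from left to right rests
  on the existence of a glued element in \<open>H\<close>; the other one is uniqueness.\<close>

lemma conc_eq_iff:
  fixes n :: "'w \<Rightarrow> nat"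
  assumes H: "sigma_stable M smul H" "\<And>i. g i \<in> H"
    and n[measurable]: "n \<in> measurable M (count_space UNIV)"
  shows "conc M smul (\<lambda>l. {w \<in> space M. n w = l}) g = y \<longleftrightarrow> (AE w in M. dist_at w y (g (n w)) = 0)"
proof -
  have *: "conc M smul (\<lambda>l. {w \<in> space M. n w = l}) g = y" if "AE w in M. dist_at w y (g (n w)) = 0" for y
  proof (rule conc_eqI[OF countable_partition_nat[OF n]])
    fix l
    have A: "{w \<in> space M. n w = l} \<in> sets M"
      by measurable
    have "AE w in M. w \<in> {w \<in> space M. n w = l} \<longrightarrow> dist_at w y (g l) = 0"
      using that by eventually_elim auto
    then show "smul (L0_ind M {w \<in> space M. n w = l}) y = smul (L0_ind M {w \<in> space M. n w = l}) (g l)"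
      using smul_ind_eq_iff[OF A] by blast
  qed
  obtain y' where y': "AE w in M. dist_at w y' (g (n w)) = 0"
    using sigma_stable_glue[of H g n, OF assms] by blast
  show ?thesis
    using *[of y'] y' *[of y] by auto
qed

lemma sigma_stable_map_glue:
  fixes n :: "'w \<Rightarrow> nat"
  assumes T: "sigma_stable_map M smul G H T" and g: "\<And>i. g i \<in> G"
    and n: "n \<in> measurable M (count_space UNIV)"
    and y: "AE w in M. dist_at w y (g (n w)) = 0"
  shows "AE w in M. dist_at w (T y) (T (g (n w))) = 0"
proof -
  let ?A = "\<lambda>l::nat. {w \<in> space M. n w = l}"
  have G: "sigma_stable M smul G" and H: "sigma_stable M smul H" and TG: "\<And>i. T (g i) \<in> H"
    using T g by (auto simp: sigma_stable_map_def)
  have "conc M smul ?A g = y"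
    using conc_eq_iff[of G g n y, OF G g n] y by simp
  moreover have "T (conc M smul ?A g) = conc M smul ?A (\<lambda>l. T (g l))"
  proof -
    have "range g \<subseteq> G" using g by auto
    then show ?thesis
      using T countable_partition_nat[OF n] unfolding sigma_stable_map_def by blast
  qed
  ultimately show ?thesis
    using conc_eq_iff[of H "\<lambda>l. T (g l)" n "T y", OF H TG n] by simp
qed

text \<open>The extra thinning \<open>r\<close> is deterministic, so measurability and strict growth
  of the random indices would survive it.\<close>

lemma random_subseq_AE:
  fixes x :: "nat \<Rightarrow> 'e"
  assumes "limitin (el_topology M rnorm) y l sequentially"
    and "\<And>k. AE w in M. dist_at w (y k) (x (n k w)) = 0"
  shows "\<exists>r. strict_mono r \<and> (AE w in M. (\<lambda>k. dist_at w (x (n (r k) w)) l) \<longlonglongrightarrow> 0)"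
proof -
  obtain r where r: "strict_mono r" "AE w in M. (\<lambda>k. dist_at w (y (r k)) l) \<longlonglongrightarrow> 0"
    using limitin_AE_subseq[OF assms(1)] by blast
  have "AE w in M. \<forall>k. dist_at w (y k) (x (n k w)) = 0"
    using assms(2) by (simp add: AE_all_countable)
  moreover have "AE w in M. pmet_on (insert l (range y \<union> range x)) w"
    by (rule AE_pmet_on) auto
  ultimately have "AE w in M. (\<lambda>k. dist_at w (x (n (r k) w)) l) \<longlonglongrightarrow> 0"
    using r(2)
  proof eventually_elim
    case (elim w)
    have "dist_at w (y (r k)) l = dist_at w (x (n (r k) w)) l" for k
      by (rule pmet_on_eq[OF elim(2)]) (use elim(1) in auto)
    with elim(3) show ?case by simp
  qed
  with r(1) show ?thesis by blast
qed

text \<open>The diagonal extraction of a Cauchy subsequence from a totally bounded one is performed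
  at every \<open>w\<close>. All choices are made by \<open>LEAST\<close> over the natural numbers,
  which keeps them measurable in \<open>w\<close>.\<close>

lemma random_cauchy_subseq:
  fixes g :: "nat \<Rightarrow> 'e" and a :: "nat \<Rightarrow> 'w \<Rightarrow> nat"
  assumes tb: "AE w in M. \<forall>e>0. \<exists>F. finite F \<and> (\<forall>i. \<exists>j\<in>F. dist_at w (g i) (g j) < e)"
    and a[measurable]: "\<And>k. a k \<in> measurable M (count_space UNIV)"
  shows "\<exists>n :: nat \<Rightarrow> 'w \<Rightarrow> nat. (\<forall>k. n k \<in> measurable M (count_space UNIV)) \<and>
    (AE w in M. strict_mono (\<lambda>k. n k w) \<and>
      (\<forall>e>0. \<exists>N. \<forall>k\<ge>N. \<forall>l\<ge>N. dist_at w (g (a (n k w) w)) (g (a (n l w) w)) < e))"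
proof -
  define cell where "cell m j k w \<longleftrightarrow> dist_at w (g (a k w)) (g j) < 1 / real (Suc m)" for m j k w
  txt \<open>\<open>J m k w\<close> says that index \<open>k\<close> survives \<open>m\<close> rounds, each of which keeps the first cell that
    contains infinitely many survivors.\<close>
  define J where "J = rec_nat (\<lambda>(k::nat) w. True) (\<lambda>m Jm k w. Jm k w \<and>
     cell m (LEAST j. \<forall>K. \<exists>k\<ge>K. Jm k w \<and> cell m j k w) k w)"
  \<comment> \<open>The centres range over all \<open>g j\<close>, because a finite net would depend
    on \<open>w\<close>; the net serves only to show that some centre works.\<close>
  define c where "c m w = (LEAST j. \<forall>K. \<exists>k\<ge>K. J m k w \<and> cell m j k w)" for m w
  have J0: "J 0 k w" for k w
    by (simp add: J_def)
  have JS: "J (Suc m) k w \<longleftrightarrow> J m k w \<and> cell m (c m w) k w" for m k w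
    by (simp add: J_def c_def)
  have [measurable]: "Measurable.pred M (\<lambda>w. cell m j k w)" for m j k
  proof -
    have [measurable]: "(\<lambda>w. dist_at w (g (a k w)) (g j)) \<in> borel_measurable M"
      by (rule measurable_compose_countable[where f="\<lambda>i w. dist_at w (g i) (g j)", OF _ a]) simp
    show ?thesis
      unfolding cell_def by measurable
  qed
  have J_meas [measurable]: "Measurable.pred M (\<lambda>w. J m k w)" for m k
  proof (induction m arbitrary: k)
    case 0
    then show ?case by (simp add: J0)
  next
    case (Suc m)
    note Suc[measurable]
    have [measurable]: "c m \<in> measurable M (count_space UNIV)"
      unfolding c_def by measurable
    have "Measurable.pred M (\<lambda>w. cell m (c m w) k w)"
      by (rule measurable_compose_countable[where f="\<lambda>j w. cell m j k w"]) measurable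
    then show ?case
      unfolding JS using Suc by measurable
  qed
  \<comment> \<open>The start \<open>n 0\<close> is arbitrary; at good \<open>w\<close>,
    \<open>n (Suc m)\<close> survives \<open>Suc m\<close> rounds and exceeds
    \<open>n m\<close>.\<close>
  define n where "n = rec_nat (\<lambda>w. 0::nat) (\<lambda>m nm w. LEAST k. J (Suc m) k w \<and> nm w < k)"
  have nS: "n (Suc m) w = (LEAST k. J (Suc m) k w \<and> n m w < k)" for m w
    by (simp add: n_def)
  have n_meas: "n k \<in> measurable M (count_space UNIV)" for k
  proof (induction k)
    case 0
    then show ?case by (simp add: n_def)
  next
    case (Suc k)
    note Suc[measurable]
    show ?case
      unfolding nS by measurable
  qed
  have "AE w in M. pmet_on (range g) w"
    by (rule AE_pmet_on) auto
  with tb have "AE w in M. strict_mono (\<lambda>k. n k w) \<and>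
      (\<forall>e>0. \<exists>N. \<forall>k\<ge>N. \<forall>l\<ge>N. dist_at w (g (a (n k w) w)) (g (a (n l w) w)) < e)"
  proof eventually_elim
    case (elim w)
    note pm = pmet_onD[OF elim(2)]
    have inf: "\<forall>K. \<exists>k\<ge>K. J m k w" for m
    proof (induction m)
      case 0
      then show ?case by (auto simp: J0)
    next
      case (Suc m)
      have infJ: "infinite {k. J m k w}"
        using Suc by (simp add: infinite_nat_iff_unbounded_le)
      obtain F where F: "finite F" "\<And>i. \<exists>j\<in>F. dist_at w (g i) (g j) < 1 / real (Suc m)"
        using elim(1)[rule_format, of "1 / real (Suc m)"] by auto
      \<comment> \<open>Pigeonhole: finitely many cells cover an infinite set of survivors.\<close>
      have "{k. J m k w} = (\<Union>j\<in>F. {k. J m k w \<and> cell m j k w})"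
        using F(2) by (auto simp: cell_def)
      then obtain j where "infinite {k. J m k w \<and> cell m j k w}"
        using infJ F(1) by (metis (no_types, lifting) finite_UN)
      then have "\<forall>K. \<exists>k\<ge>K. J m k w \<and> cell m j k w"
        by (simp add: infinite_nat_iff_unbounded_le)
      then have "\<forall>K. \<exists>k\<ge>K. J m k w \<and> cell m (c m w) k w"
        unfolding c_def by (rule LeastI)
      then show ?case by (simp add: JS)
    qed
    have n: "J (Suc m) (n (Suc m) w) w \<and> n m w < n (Suc m) w" for m
    proof -
      have "\<exists>k. J (Suc m) k w \<and> n m w < k"
        using inf[of "Suc m"] by (metis Suc_le_eq)
      then show ?thesis
        unfolding nS[of m w] by (rule LeastI_ex)
    qed
    have mono: "J m k w" if "J m' k w" "m \<le> m'" for m m' k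
      using that(2,1) by (induction rule: dec_induct) (auto simp: JS)
    have cauchy: "\<exists>N. \<forall>k\<ge>N. \<forall>l\<ge>N. dist_at w (g (a (n k w) w)) (g (a (n l w) w)) < e" if "e > 0" for e :: real
    proof -
      obtain m where m: "1 / real (Suc m) < e / 2"
        using \<open>e > 0\<close> by (meson half_gt_zero nat_approx_posE)
      have near: "dist_at w (g (a (n k w) w)) (g (c m w)) < e / 2" if "k \<ge> Suc m" for k
      proof -
        obtain k' where "k = Suc k'" using \<open>k \<ge> Suc m\<close> by (cases k) auto
        then have "J (Suc m) (n k w) w"
          using n[of k'] mono[of k "n k w" "Suc m"] that by simp
        then show ?thesis
          using m by (simp add: JS cell_def)
      qed
      have "dist_at w (g (a (n k w) w)) (g (a (n l w) w)) < e" if "k \<ge> Suc m" "l \<ge> Suc m" for k l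
        using near[OF that(1)] near[OF that(2)]
          pm(4)[of "g (a (n k w) w)" "g (c m w)" "g (a (n l w) w)"]
          pm(3)[of "g (c m w)" "g (a (n l w) w)"] by simp
      then show ?thesis by blast
    qed
    have "strict_mono (\<lambda>k. n k w)"
      unfolding strict_mono_Suc_iff using n by blast
    then show ?case
      by (intro conjI allI impI cauchy)
  qed
  with n_meas show ?thesis
    by blast
qed

section \<open>Countable carriers for Schauder's argument\<close>

text \<open>All operations are applied stage by stage from \<open>{x0, 0}\<close>. The stages
  increase, so two elements of the union lie in a common stage and their sum in the next
  one.\<close>

lemma countable_closure:
  obtains V where "countable V" "x0 \<in> V" "0 \<in> V" "\<And>x y. x \<in> V \<Longrightarrow> y \<in> V \<Longrightarrow> x + y \<in> V"
    "\<And>q x. q \<in> \<rat> \<Longrightarrow> x \<in> V \<Longrightarrow> sc q x \<in> V" "\<And>x. x \<in> V \<Longrightarrow> f x \<in> V"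
proof -
  define step where "step W = W \<union> (\<lambda>(x, y). x + y) ` (W \<times> W) \<union> (\<lambda>(q, x). sc q x) ` (\<rat> \<times> W) \<union> f ` W" for W
  define V where "V = (\<Union>n. (step ^^ n) {x0, 0})"
  have "countable ((step ^^ n) {x0, 0})" for n
    by (induction n) (auto simp: step_def countable_rat)
  then have "countable V"
    by (simp add: V_def)
  have "incseq (\<lambda>n. (step ^^ n) {x0, 0})"
    by (rule incseq_SucI) (auto simp: step_def)
  then have mono: "(step ^^ m) {x0, 0} \<subseteq> (step ^^ n) {x0, 0}" if "m \<le> n" for m n
    using that unfolding incseq_def by blast
  have V2: "\<exists>n. x \<in> (step ^^ n) {x0, 0} \<and> y \<in> (step ^^ n) {x0, 0}" if xy: "x \<in> V" "y \<in> V" for x y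
  proof -
    obtain i j where "x \<in> (step ^^ i) {x0, 0}" "y \<in> (step ^^ j) {x0, 0}"
      using xy by (auto simp: V_def)
    then show ?thesis
      using mono[of i "max i j"] mono[of j "max i j"] by (intro exI[of _ "max i j"]) auto
  qed
  have step_V: "z \<in> V" if "z \<in> step ((step ^^ n) {x0, 0})" for z n
    using that unfolding V_def by (intro UN_I[of "Suc n"]) auto
  show thesis
  proof (rule that[of V])
    fix x y assume "x \<in> V" "y \<in> V"
    from V2[OF this] obtain n where "x \<in> (step ^^ n) {x0, 0}" "y \<in> (step ^^ n) {x0, 0}" by blast
    then show "x + y \<in> V"
      by (intro step_V[of _ n]) (auto simp: step_def)
  next
    fix q :: real and x assume "q \<in> \<rat>" "x \<in> V"
    from V2[OF this(2) this(2)] obtain n where "x \<in> (step ^^ n) {x0, 0}" by blast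
    with \<open>q \<in> \<rat>\<close> show "sc q x \<in> V"
      by (intro step_V[of _ n]) (auto simp: step_def)
  next
    fix x assume "x \<in> V"
    from V2[OF this this] obtain n where "x \<in> (step ^^ n) {x0, 0}" by blast
    then show "f x \<in> V"
      by (intro step_V[of _ n]) (auto simp: step_def)
  next
    show "x0 \<in> V" "0 \<in> V"
      unfolding V_def by (auto intro!: exI[of _ 0])
  qed fact
qed

lemma AE_rational_seminorm:
  assumes V: "countable V" "0 \<in> V" "\<And>x y. x \<in> V \<Longrightarrow> y \<in> V \<Longrightarrow> x + y \<in> V"
    "\<And>q x. q \<in> \<rat> \<Longrightarrow> x \<in> V \<Longrightarrow> sc q x \<in> V"
  shows "AE w in M. rational_seminorm sc V (\<lambda>x. nrm x w)"
proof -
  have "AE w in M. \<forall>x\<in>V. \<forall>y\<in>V. nrm (x + y) w \<le> nrm x w + nrm y w"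
    by (rule AE_countable_pairs[OF V(1) V(1) nrm_add])
  moreover have "AE w in M. \<forall>q\<in>\<rat>. \<forall>x\<in>V. nrm (sc q x) w = \<bar>q\<bar> * nrm x w"
    by (rule AE_countable_pairs[OF countable_rat V(1) nrm_sc])
  ultimately show ?thesis
    by eventually_elim (unfold_locales, use V in auto)
qed

lemma L0_convexD:
  assumes "L0_convex M smul G" "x \<in> G" "y \<in> G" "0 \<le> q" "q \<le> 1"
  shows "sc q x + sc (1 - q) y \<in> G"
proof -
  have r: "L0_of_real M (L0_const M q) = L0_const M (of_real q :: 'k)"
    by (subst L0_map_class) auto
  have d: "L0_diff M (L0_const M 1) (L0_const M (of_real q)) = L0_const M (of_real (1 - q) :: 'k)"
    by (subst L0_map2_class) auto
  have "L0_const M q \<in> L0_plus M"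
    using assms(4) by (simp add: L0_plus_def L0_class_in L0_le_class)
  moreover have "L0_le M (L0_const M q) (L0_const M 1)"
    using assms(5) by (simp add: L0_le_class)
  ultimately have "smul (L0_of_real M (L0_const M q)) x +
      smul (L0_diff M (L0_const M 1) (L0_of_real M (L0_const M q))) y \<in> G"
    using assms(1-3) unfolding L0_convex_def by blast
  then show ?thesis
    by (simp only: r d sc_def)
qed

end


section \<open>The random Krasnoselskii theorem\<close>

locale krasnoselskii = rn_module M smul rnorm
  for M :: "'w measure"
    and smul :: "('w \<Rightarrow> 'k::{real_normed_field,euclidean_space}) set \<Rightarrow> 'e::ab_group_add \<Rightarrow> 'e"
    and rnorm :: "'e \<Rightarrow> ('w \<Rightarrow> real) set" +
  fixes G :: "'e set" and S T :: "'e \<Rightarrow> 'e"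
  assumes complete: "el_complete M rnorm TYPE('e)"
    and closed: "closedin (el_topology M rnorm) G"
    and convex: "L0_convex M smul G"
    and contr: "random_contractive M rnorm G S"
    and T_stable: "sigma_stable_map M smul G UNIV T"
    and T_cont: "random_seq_continuous M smul rnorm G T"
    and T_compact: "random_rel_seq_compact M smul rnorm (T ` G)"
    and S_T: "x \<in> G \<Longrightarrow> y \<in> G \<Longrightarrow> S x + T y \<in> G"
begin

section \<open>Pointwise consequences of the hypotheses on \<open>T\<close>\<close>

lemma G_stable: "sigma_stable M smul G"
  using T_stable by (simp add: sigma_stable_map_def)

lemma glue:
  fixes n :: "'w \<Rightarrow> nat"
  assumes "\<And>i. g i \<in> G" "n \<in> measurable M (count_space UNIV)"
  obtains y where "y \<in> G" "AE w in M. dist_at w y (g (n w)) = 0"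
    "AE w in M. dist_at w (T y) (T (g (n w))) = 0"
proof -
  obtain y where y: "y \<in> G" "AE w in M. dist_at w y (g (n w)) = 0"
    using sigma_stable_glue[of G g n, OF G_stable assms] by blast
  with sigma_stable_map_glue[of G UNIV T g n y, OF T_stable assms] that show thesis by blast
qed

lemma glue_seq:
  fixes n :: "nat \<Rightarrow> 'w \<Rightarrow> nat"
  assumes "\<And>i. g i \<in> G" "\<And>k. n k \<in> measurable M (count_space UNIV)"
  obtains h where "\<And>k. h k \<in> G" "AE w in M. \<forall>k. dist_at w (h k) (g (n k w)) = 0"
    "AE w in M. \<forall>k. dist_at w (T (h k)) (T (g (n k w))) = 0"
proof -
  have "\<exists>y. y \<in> G \<and> (AE w in M. dist_at w y (g (n k w)) = 0) \<and>
    (AE w in M. dist_at w (T y) (T (g (n k w))) = 0)" for k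
  proof -
    obtain y where "y \<in> G" "AE w in M. dist_at w y (g (n k w)) = 0"
      "AE w in M. dist_at w (T y) (T (g (n k w))) = 0"
      by (rule glue[of g "n k"]) (use assms in auto)
    then show ?thesis by blast
  qed
  then have "\<exists>h. \<forall>k. h k \<in> G \<and> (AE w in M. dist_at w (h k) (g (n k w)) = 0) \<and>
    (AE w in M. dist_at w (T (h k)) (T (g (n k w))) = 0)"
    by (intro choice allI)
  then obtain h where "\<forall>k. h k \<in> G \<and> (AE w in M. dist_at w (h k) (g (n k w)) = 0) \<and>
    (AE w in M. dist_at w (T (h k)) (T (g (n k w))) = 0)" ..
  then show thesis
    by (intro that[of h]) (simp_all add: AE_all_countable)
qed

text \<open>Random relative compactness in pointwise form: the concatenations are read as random
  indices and thinned until convergence is almost sure.\<close>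

lemma T_compact_AE:
  assumes "\<And>i. g i \<in> G"
  obtains n :: "nat \<Rightarrow> 'w \<Rightarrow> nat" and l where
    "\<And>k. n k \<in> measurable M (count_space UNIV)" "\<And>w. w \<in> space M \<Longrightarrow> strict_mono (\<lambda>k. n k w)"
    "AE w in M. (\<lambda>k. dist_at w (T (g (n k w))) l) \<longlonglongrightarrow> 0"
proof -
  obtain H where H: "T ` G \<subseteq> H" "sigma_stable M smul H"
    and sub: "\<And>x. range x \<subseteq> T ` G \<Longrightarrow>
      \<exists>y l. random_subseq M smul H x y \<and> limitin (el_topology M rnorm) y l sequentially"
    using T_compact unfolding random_rel_seq_compact_def by blast
  have "range (\<lambda>i. T (g i)) \<subseteq> T ` G"
    using assms by auto
  from sub[OF this] obtain y l where y: "random_subseq M smul H (\<lambda>i. T (g i)) y"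
    and l: "limitin (el_topology M rnorm) y l sequentially"
    by blast
  from y obtain n where n: "\<And>k. n k \<in> measurable M (count_space UNIV)"
    "\<And>k w. w \<in> space M \<Longrightarrow> n k w < n (Suc k) w"
    and yk: "\<And>k. y k = conc M smul (\<lambda>l. {w \<in> space M. n k w = l}) (\<lambda>i. T (g i))"
    unfolding random_subseq_def by blast
  have TH: "T (g i) \<in> H" for i
    using H(1) assms by auto
  have "AE w in M. dist_at w (y k) (T (g (n k w))) = 0" for k
    using conc_eq_iff[of H "\<lambda>i. T (g i)" "n k" "y k", OF H(2) TH n(1)] yk[of k] by simp
  then obtain r where r: "strict_mono r" "AE w in M. (\<lambda>k. dist_at w (T (g (n (r k) w))) l) \<longlonglongrightarrow> 0"
    using random_subseq_AE[where y=y and l=l and x="\<lambda>i. T (g i)" and n=n, OF l] by blast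
  show thesis
  proof (rule that[of "\<lambda>k. n (r k)" l])
    fix w assume "w \<in> space M"
    then have "strict_mono (\<lambda>k. n k w)"
      using n(2) by (simp add: strict_mono_Suc_iff)
    with r(1) show "strict_mono (\<lambda>k. n (r k) w)"
      by (simp add: strict_mono_def)
  qed (use n r in auto)
qed

lemma T_cont_subseq:
  assumes x: "\<And>i. x i \<in> G" and "x0 \<in> G" and l: "AE w in M. (\<lambda>i. dist_at w (x i) x0) \<longlonglongrightarrow> 0"
  obtains n :: "nat \<Rightarrow> 'w \<Rightarrow> nat" where
    "AE w in M. (\<lambda>k. dist_at w (T (x (n k w))) (T x0)) \<longlonglongrightarrow> 0"
proof -
  have "range x \<subseteq> G" using x by auto
  then obtain y where y: "random_subseq M smul G x y"
    and l: "limitin (el_topology M rnorm) (\<lambda>k. T (y k)) (T x0) sequentially"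
    using T_cont limitin_if_AE[OF l] \<open>x0 \<in> G\<close> unfolding random_seq_continuous_def by blast
  from y obtain n where n: "\<And>k. n k \<in> measurable M (count_space UNIV)"
    and yk: "\<And>k. y k = conc M smul (\<lambda>l. {w \<in> space M. n k w = l}) x"
    unfolding random_subseq_def by blast
  have "AE w in M. dist_at w (y k) (x (n k w)) = 0" for k
    using conc_eq_iff[of G x "n k" "y k", OF G_stable x n(1)] yk[of k] by simp
  then have "AE w in M. dist_at w (T (y k)) (T (x (n k w))) = 0" for k
    by (rule sigma_stable_map_glue[of G UNIV T x "n k", OF T_stable x n(1)])
  then obtain r where r: "strict_mono r" "AE w in M. (\<lambda>k. dist_at w (T (x (n (r k) w))) (T x0)) \<longlonglongrightarrow> 0"
    using random_subseq_AE[where y="\<lambda>k. T (y k)" and l="T x0" and x="\<lambda>i. T (x i)" and n=n, OF l] by blast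
  then show thesis
    by (intro that[of "\<lambda>k. n (r k)"])
qed

text \<open>From random subsequences to the whole sequence. Where the images stay
  \<open>\<eta>\<close> away from \<open>T x0\<close> infinitely often, later and later such terms
  are glued; the result still converges to \<open>x0\<close>, but no choice of indices brings its
  images near \<open>T x0\<close>, so this event is null.\<close>

lemma T_cont_AE:
  assumes g: "\<And>i. g i \<in> G" and "x0 \<in> G" and l: "AE w in M. (\<lambda>i. dist_at w (g i) x0) \<longlonglongrightarrow> 0"
  shows "AE w in M. (\<lambda>i. dist_at w (T (g i)) (T x0)) \<longlonglongrightarrow> 0"
proof -
  have step: "AE w in M. \<exists>k. \<forall>i\<ge>k. dist_at w (T (g i)) (T x0) < \<eta>" if "\<eta> > 0" for \<eta> :: real
  proof -
    define bad where "bad w \<longleftrightarrow> (\<forall>k. \<exists>i\<ge>k. \<eta> \<le> dist_at w (T (g i)) (T x0))" for w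
    \<comment> \<open>Off \<open>bad\<close> the index is just \<open>k\<close>, so that the glued
      sequence converges to \<open>x0\<close> almost everywhere and not only on
      \<open>bad\<close>.\<close>
    define m where "m k w = (LEAST i. k \<le> i \<and> (bad w \<longrightarrow> \<eta> \<le> dist_at w (T (g i)) (T x0)))" for k w
    have [measurable]: "Measurable.pred M bad"
      unfolding bad_def by measurable
    have [measurable]: "m k \<in> measurable M (count_space UNIV)" for k
      unfolding m_def by measurable
    have m: "k \<le> m k w \<and> (bad w \<longrightarrow> \<eta> \<le> dist_at w (T (g (m k w))) (T x0))" for k w
      unfolding m_def by (rule LeastI_ex) (auto simp: bad_def)
    obtain h where h: "\<And>k. h k \<in> G" "AE w in M. \<forall>k. dist_at w (h k) (g (m k w)) = 0"
      "AE w in M. \<forall>k. dist_at w (T (h k)) (T (g (m k w))) = 0"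
      by (rule glue_seq[of g m]) (use g in auto)
    have pm: "AE w in M. pmet_on ({x0, T x0} \<union> range g \<union> range h \<union> range (\<lambda>i. T (g i)) \<union> range (\<lambda>i. T (h i))) w"
      by (rule AE_pmet_on) auto
    have "AE w in M. (\<lambda>k. dist_at w (h k) x0) \<longlonglongrightarrow> 0"
      using l h(2) pm
    proof eventually_elim
      case (elim w)
      have "filterlim (\<lambda>k. m k w) at_top sequentially"
        by (rule filterlim_at_top_mono[OF filterlim_ident]) (use m in auto)
      then have "(\<lambda>k. dist_at w (g (m k w)) x0) \<longlonglongrightarrow> 0"
        by (rule filterlim_compose[OF elim(1)])
      moreover have "dist_at w (h k) x0 = dist_at w (g (m k w)) x0" for k
        by (rule pmet_on_eq[OF elim(3)]) (use elim(2) in auto)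
      ultimately show ?case by simp
    qed
    then obtain n :: "nat \<Rightarrow> 'w \<Rightarrow> nat" where
      "AE w in M. (\<lambda>k. dist_at w (T (h (n k w))) (T x0)) \<longlonglongrightarrow> 0"
      using T_cont_subseq[of h x0] h(1) \<open>x0 \<in> G\<close> by blast
    then have "AE w in M. \<not> bad w"
      using h(3) pm
    proof eventually_elim
      case (elim w)
      have "dist_at w (T (h k)) (T x0) = dist_at w (T (g (m k w))) (T x0)" for k
        by (rule pmet_on_eq[OF elim(3)]) (use elim(2) in auto)
      then have "bad w \<Longrightarrow> \<eta> \<le> dist_at w (T (h k)) (T x0)" for k
        using m[of k w] by simp
      moreover obtain k where "dist_at w (T (h (n k w))) (T x0) < \<eta>"
        using order_tendstoD(2)[OF elim(1) \<open>\<eta> > 0\<close>] by (auto simp: eventually_sequentially)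
      ultimately show ?case
        by (meson not_le)
    qed
    then show ?thesis
      unfolding bad_def by eventually_elim (meson not_le)
  qed
  have "AE w in M. \<forall>j. \<exists>k. \<forall>i\<ge>k. dist_at w (T (g i)) (T x0) < 1 / real (Suc j)"
    unfolding AE_all_countable by (intro allI step) simp
  moreover have "AE w in M. pmet_on ({T x0} \<union> range (\<lambda>i. T (g i))) w"
    by (rule AE_pmet_on) auto
  ultimately show ?thesis
  proof eventually_elim
    case (elim w)
    show ?case
    proof (rule LIMSEQ_I)
      fix e :: real assume "e > 0"
      then obtain j where "1 / real (Suc j) < e"
        by (rule nat_approx_posE)
      then obtain k where "\<And>i. i \<ge> k \<Longrightarrow> dist_at w (T (g i)) (T x0) < e"
        using elim(1) by (meson order_less_trans)
      then show "\<exists>k. \<forall>i\<ge>k. norm (dist_at w (T (g i)) (T x0) - 0) < e"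
        using pmet_onD(1)[OF elim(2)] by (intro exI[of _ k]) simp
    qed
  qed
qed

text \<open>Where total boundedness fails for some \<open>e\<close>, a sequence with
  \<open>e\<close>-separated images is picked greedily. Gluing makes it one sequence in
  \<open>G\<close>, whose images have an almost surely convergent random subsequence, so the failure
  has probability 0.\<close>

lemma T_totally_bounded:
  assumes g: "\<And>i. g i \<in> G"
  shows "AE w in M. \<forall>e>0. \<exists>N::nat. \<forall>i. \<exists>j\<le>N. dist_at w (T (g i)) (T (g j)) < e"
proof -
  have step: "AE w in M. \<exists>N. \<forall>i. \<exists>j\<le>N. dist_at w (T (g i)) (T (g j)) < e" if "e > 0" for e :: real
  proof -
    define bad where "bad w \<longleftrightarrow> (\<forall>N. \<exists>i. \<forall>j\<le>N. e \<le> dist_at w (T (g i)) (T (g j)))" for w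
    \<comment> \<open>Off \<open>bad\<close> the \<open>LEAST\<close> may have no witness; its
      unspecified value is harmless, since separation is claimed on \<open>bad\<close> only.\<close>
    define m where "m = rec_nat (\<lambda>w. 0) (\<lambda>k mk w. LEAST i. \<forall>j. j \<le> mk w \<longrightarrow> e \<le> dist_at w (T (g i)) (T (g j)))"
    have mS: "m (Suc k) w = (LEAST i. \<forall>j. j \<le> m k w \<longrightarrow> e \<le> dist_at w (T (g i)) (T (g j)))" for k w
      by (simp add: m_def)
    have m_meas: "m k \<in> measurable M (count_space UNIV)" for k
    proof (induction k)
      case 0
      then show ?case by (simp add: m_def)
    next
      case (Suc k)
      note Suc[measurable]
      show ?case
        unfolding mS by measurable
    qed
    obtain h where h: "\<And>k. h k \<in> G" "AE w in M. \<forall>k. dist_at w (T (h k)) (T (g (m k w))) = 0"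
      by (rule glue_seq[of g m]) (use g m_meas in auto)
    obtain n :: "nat \<Rightarrow> 'w \<Rightarrow> nat" and l where n: "\<And>w. w \<in> space M \<Longrightarrow> strict_mono (\<lambda>k. n k w)"
      and l: "AE w in M. (\<lambda>k. dist_at w (T (h (n k w))) l) \<longlonglongrightarrow> 0"
      by (rule T_compact_AE[of h]) (use h in auto)
    have pm: "AE w in M. pmet_on ({l} \<union> range (\<lambda>i. T (g i)) \<union> range (\<lambda>i. T (h i))) w"
      by (rule AE_pmet_on) auto
    have "AE w in M. \<not> bad w"
      using l h(2) pm AE_space
    proof eventually_elim
      case (elim w)
      note pm = pmet_onD[OF elim(3)]
      show ?case
      proof
        assume bad: "bad w"
        have far: "\<forall>j. j \<le> m k w \<longrightarrow> e \<le> dist_at w (T (g (m (Suc k) w))) (T (g j))" for k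
          unfolding mS by (rule LeastI_ex) (use bad in \<open>auto simp: bad_def\<close>)
        \<comment> \<open>Otherwise \<open>far\<close> would separate an image from itself.\<close>
        have "m k w < m (Suc k) w" for k
          using far[of k] pm(2)[of "T (g (m (Suc k) w))"] \<open>e > 0\<close> by (metis UnCI not_le rangeI)
        then have mono: "strict_mono (\<lambda>k. m k w)"
          by (simp add: strict_mono_Suc_iff)
        have sep: "e \<le> dist_at w (T (h b)) (T (h a))" if "a < b" for a b
        proof -
          obtain b' where b': "b = Suc b'" "a \<le> b'"
            using \<open>a < b\<close> by (cases b) auto
          then have "m a w \<le> m b' w"
            using strict_mono_less_eq[OF mono] by blast
          then have "e \<le> dist_at w (T (g (m b w))) (T (g (m a w)))"
            using far[of b'] b' by simp
          also have "\<dots> = dist_at w (T (h b)) (T (g (m a w)))"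
            by (rule pmet_on_eq(1)[OF elim(3), symmetric]) (use elim(2) in auto)
          also have "\<dots> = dist_at w (T (h b)) (T (h a))"
            by (rule pmet_on_eq(2)[OF elim(3), symmetric]) (use elim(2) in auto)
          finally show ?thesis .
        qed
        obtain k where k: "\<And>i. i \<ge> k \<Longrightarrow> dist_at w (T (h (n i w))) l < e / 2"
          using order_tendstoD(2)[OF elim(1), of "e/2"] \<open>e > 0\<close> by (auto simp: eventually_sequentially)
        have "n k w < n (Suc k) w"
          using n[OF elim(4)] by (simp add: strict_mono_Suc_iff)
        from sep[OF this] show False
          using k[of k] k[of "Suc k"] pm(4)[of "T (h (n (Suc k) w))" l "T (h (n k w))"]
            pm(3)[of l "T (h (n k w))"] by simp
      qed
    qed
    then show ?thesis
      unfolding bad_def by eventually_elim (meson not_le)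
  qed
  have "AE w in M. \<forall>k. \<exists>N. \<forall>i. \<exists>j\<le>N. dist_at w (T (g i)) (T (g j)) < 1 / real (Suc k)"
    unfolding AE_all_countable by (intro allI step) simp
  then show ?thesis
  proof eventually_elim
    case (elim w)
    show ?case
    proof (intro allI impI)
      fix e :: real assume "e > 0"
      then obtain k where "1 / real (Suc k) < e"
        by (rule nat_approx_posE)
      then show "\<exists>N. \<forall>i. \<exists>j\<le>N. dist_at w (T (g i)) (T (g j)) < e"
        using elim by (meson order_less_trans)
    qed
  qed
qed

text \<open>A random Heine-Cantor theorem. Where uniform continuity fails, pairs at distance below
  \<open>1 / Suc k\<close> with images \<open>\<eta>\<close> apart are chosen measurably. Total
  boundedness and completeness make the left members converge to some \<open>x0\<close> in
  \<open>G\<close>, the right members follow, and \<open>T_cont_AE\<close> sends both image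
  sequences to \<open>T x0\<close>.\<close>

lemma T_unif_cont:
  assumes g: "\<And>i. g i \<in> G"
    and tb: "AE w in M. \<forall>e>0. \<exists>F. finite F \<and> (\<forall>i::nat. \<exists>j\<in>F. dist_at w (g i) (g j) < e)"
  shows "AE w in M. \<forall>\<eta>>0. \<exists>\<delta>>0. \<forall>i j. dist_at w (g i) (g j) < \<delta> \<longrightarrow> dist_at w (T (g i)) (T (g j)) < \<eta>"
proof -
  have step: "AE w in M. \<exists>k. \<forall>i j. dist_at w (g i) (g j) < 1 / real (Suc k) \<longrightarrow>
    dist_at w (T (g i)) (T (g j)) < \<eta>" if "\<eta> > 0" for \<eta> :: real
  proof -
    define bad where "bad w \<longleftrightarrow> (\<forall>k. \<exists>i j. dist_at w (g i) (g j) < 1 / real (Suc k) \<and>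
      \<eta> \<le> dist_at w (T (g i)) (T (g j)))" for w
    \<comment> \<open>Pairs are coded by numbers so that one \<open>LEAST\<close> selects both
      members.\<close>
    define l r :: "nat \<Rightarrow> nat" where "l z = fst (prod_decode z)" and "r z = snd (prod_decode z)" for z
    \<comment> \<open>Off \<open>bad\<close> only closeness is required, which the pair
      \<open>(0, 0)\<close> satisfies; the glued sequences thus converge almost everywhere, as
      \<open>T_cont_AE\<close> demands.\<close>
    define Q where "Q k z w \<longleftrightarrow> dist_at w (g (l z)) (g (r z)) < 1 / real (Suc k) \<and>
      (bad w \<longrightarrow> \<eta> \<le> dist_at w (T (g (l z))) (T (g (r z))))" for k z w
    define m where "m k w = (LEAST z. Q k z w)" for k w
    have [measurable]: "Measurable.pred M bad"
      unfolding bad_def by measurable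
    have [measurable]: "Measurable.pred M (\<lambda>w. Q k z w)" for k z
      unfolding Q_def by measurable
    have [measurable]: "m k \<in> measurable M (count_space UNIV)" for k
      unfolding m_def by measurable
    have [measurable]: "(\<lambda>w. l (m k w)) \<in> measurable M (count_space UNIV)"
      "(\<lambda>w. r (m k w)) \<in> measurable M (count_space UNIV)" for k
      by measurable
    obtain n :: "nat \<Rightarrow> 'w \<Rightarrow> nat" where n[measurable]: "\<And>k. n k \<in> measurable M (count_space UNIV)"
      and cauchy: "AE w in M. strict_mono (\<lambda>k. n k w) \<and> (\<forall>e>0. \<exists>N. \<forall>j\<ge>N. \<forall>k\<ge>N.
        dist_at w (g (l (m (n j w) w))) (g (l (m (n k w) w))) < e)"
      using random_cauchy_subseq[of g "\<lambda>k w. l (m k w)", OF tb] by auto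
    have ln: "(\<lambda>w. l (m (n k w) w)) \<in> measurable M (count_space UNIV)" for k
      by (rule measurable_compose_countable[where f="\<lambda>i w. l (m i w)"]) auto
    have rn: "(\<lambda>w. r (m (n k w) w)) \<in> measurable M (count_space UNIV)" for k
      by (rule measurable_compose_countable[where f="\<lambda>i w. r (m i w)"]) auto
    obtain x where x: "\<And>k. x k \<in> G" "AE w in M. \<forall>k. dist_at w (x k) (g (l (m (n k w) w))) = 0"
      "AE w in M. \<forall>k. dist_at w (T (x k)) (T (g (l (m (n k w) w)))) = 0"
      by (rule glue_seq[of g "\<lambda>k w. l (m (n k w) w)"]) (use g ln in auto)
    obtain y where y: "\<And>k. y k \<in> G" "AE w in M. \<forall>k. dist_at w (y k) (g (r (m (n k w) w))) = 0"
      "AE w in M. \<forall>k. dist_at w (T (y k)) (T (g (r (m (n k w) w)))) = 0"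
      by (rule glue_seq[of g "\<lambda>k w. r (m (n k w) w)"]) (use g rn in auto)
    have pm: "AE w in M. pmet_on (range g \<union> range x \<union> range y) w"
      by (rule AE_pmet_on) auto
    have Q: "Q k (m k w) w" if "pmet_on (range g \<union> range x \<union> range y) w" for k w
      unfolding m_def
    proof (rule LeastI_ex, cases "bad w")
      case True
      then obtain i j where "dist_at w (g i) (g j) < 1 / real (Suc k)" "\<eta> \<le> dist_at w (T (g i)) (T (g j))"
        unfolding bad_def by blast
      then show "\<exists>z. Q k z w"
        by (intro exI[of _ "prod_encode (i, j)"]) (simp add: Q_def l_def r_def)
    next
      case False
      then show "\<exists>z. Q k z w"
        using pmet_onD(2)[OF that, of "g 0" "g 0"]
        by (intro exI[of _ "prod_encode (0, 0)"]) (simp add: Q_def l_def r_def)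
    qed
    have "AE w in M. \<forall>e>0. \<exists>N. \<forall>j\<ge>N. \<forall>k\<ge>N. dist_at w (x j) (x k) < e"
      using cauchy x(2) pm
    proof eventually_elim
      case (elim w)
      have "dist_at w (x j) (x k) = dist_at w (g (l (m (n j w) w))) (g (l (m (n k w) w)))" for j k
        using pmet_on_eq(1)[OF elim(3), of "x j" "g (l (m (n j w) w))" "x k"]
          pmet_on_eq(2)[OF elim(3), of "x k" "g (l (m (n k w) w))" "g (l (m (n j w) w))"] elim(2) by auto
      with elim(1) show ?case by simp
    qed
    from AE_complete[OF complete this] obtain x0 where x0: "AE w in M. (\<lambda>k. dist_at w (x k) x0) \<longlonglongrightarrow> 0"
      by blast
    have "x0 \<in> G"
      by (rule AE_closed[of G x x0, OF closed x(1) x0])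
    have pm0: "AE w in M. pmet_on (insert x0 (range g \<union> range x \<union> range y)) w"
      by (rule AE_pmet_on) auto
    have y0: "AE w in M. (\<lambda>k. dist_at w (y k) x0) \<longlonglongrightarrow> 0"
      using x0 cauchy x(2) y(2) pm pm0
    proof eventually_elim
      case (elim w)
      note pm = pmet_onD[OF elim(6)]
      have le: "dist_at w (y k) x0 \<le> 1 / real (Suc k) + dist_at w (x k) x0" for k
      proof -
        let ?l = "g (l (m (n k w) w))" and ?r = "g (r (m (n k w) w))"
        have "k \<le> n k w"
          using elim(2) strict_mono_imp_increasing[of "\<lambda>k. n k w" k] by simp
        then have "1 / real (Suc (n k w)) \<le> 1 / real (Suc k)"
          by (simp add: frac_le)
        then have "dist_at w ?l ?r \<le> 1 / real (Suc k)"
          using Q[OF elim(5), of "n k w"] by (simp add: Q_def)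
        moreover have "dist_at w (y k) x0 = dist_at w ?r x0"
          by (rule pmet_on_eq(1)[OF elim(6)]) (use elim(4) in auto)
        moreover have "dist_at w (x k) x0 = dist_at w ?l x0"
          by (rule pmet_on_eq(1)[OF elim(6)]) (use elim(3) in auto)
        ultimately show ?thesis
          using pm(4)[of ?r ?l x0] pm(3)[of ?l ?r] by simp
      qed
      show ?case
      proof (rule tendsto_sandwich[OF _ _ tendsto_const])
        show "\<forall>\<^sub>F k in sequentially. dist_at w (y k) x0 \<le> 1 / real (Suc k) + dist_at w (x k) x0"
          using le by simp
        show "(\<lambda>k. 1 / real (Suc k) + dist_at w (x k) x0) \<longlonglongrightarrow> 0"
          using tendsto_add[OF LIMSEQ_Suc[OF lim_1_over_n[where 'a=real]] elim(1)] by simp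
      qed (use pm(1) in auto)
    qed
    have pmT: "AE w in M. pmet_on (insert (T x0) (range (\<lambda>i. T (g i)) \<union> range (\<lambda>k. T (x k)) \<union> range (\<lambda>k. T (y k)))) w"
      by (rule AE_pmet_on) auto
    have "AE w in M. \<not> bad w"
      using T_cont_AE[of x x0, OF x(1) \<open>x0 \<in> G\<close> x0] T_cont_AE[of y x0, OF y(1) \<open>x0 \<in> G\<close> y0] x(3) y(3) pm pmT
    proof eventually_elim
      case (elim w)
      note pm = pmet_onD[OF elim(6)]
      show ?case
      proof
        assume "bad w"
        have far: "\<eta> \<le> dist_at w (T (x k)) (T x0) + dist_at w (T (y k)) (T x0)" for k
        proof -
          let ?l = "T (g (l (m (n k w) w)))" and ?r = "T (g (r (m (n k w) w)))"
          have "\<eta> \<le> dist_at w ?l ?r"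
            using Q[OF elim(5), of "n k w"] \<open>bad w\<close> by (simp add: Q_def)
          also have "\<dots> = dist_at w (T (x k)) ?r"
            by (rule pmet_on_eq(1)[OF elim(6), symmetric]) (use elim(3) in auto)
          also have "\<dots> = dist_at w (T (x k)) (T (y k))"
            by (rule pmet_on_eq(2)[OF elim(6), symmetric]) (use elim(4) in auto)
          finally show ?thesis
            using pm(4)[of "T (x k)" "T x0" "T (y k)"] pm(3)[of "T (y k)" "T x0"] by simp
        qed
        have "(\<lambda>k. dist_at w (T (x k)) (T x0) + dist_at w (T (y k)) (T x0)) \<longlonglongrightarrow> 0"
          using tendsto_add[OF elim(1,2)] by simp
        then have "\<eta> \<le> 0"
          by (rule LIMSEQ_le_const) (use far in blast)
        with \<open>\<eta> > 0\<close> show False by simp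
      qed
    qed
    then show ?thesis
      unfolding bad_def by eventually_elim (meson not_le)
  qed
  have "AE w in M. \<forall>q. \<exists>k. \<forall>i j. dist_at w (g i) (g j) < 1 / real (Suc k) \<longrightarrow>
    dist_at w (T (g i)) (T (g j)) < 1 / real (Suc q)"
    unfolding AE_all_countable by (intro allI step) simp
  then show ?thesis
  proof eventually_elim
    case (elim w)
    show ?case
    proof (intro allI impI)
      fix \<eta> :: real assume "\<eta> > 0"
      then obtain q where q: "1 / real (Suc q) < \<eta>"
        by (rule nat_approx_posE)
      obtain k where "\<And>i j. dist_at w (g i) (g j) < 1 / real (Suc k) \<Longrightarrow>
          dist_at w (T (g i)) (T (g j)) < 1 / real (Suc q)"
        using elim by blast
      with q show "\<exists>\<delta>>0. \<forall>i j. dist_at w (g i) (g j) < \<delta> \<longrightarrow> dist_at w (T (g i)) (T (g j)) < \<eta>"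
        by (intro exI[of _ "1 / real (Suc k)"]) force
    qed
  qed
qed

section \<open>The contraction \<open>S\<close> and the resolvent\<close>

definition contraction_factor :: "('w \<Rightarrow> real) \<Rightarrow> bool" where
  "contraction_factor a \<longleftrightarrow> (AE w in M. 0 \<le> a w \<and> a w < 1) \<and>
     (\<forall>x\<in>G. \<forall>y\<in>G. AE w in M. dist_at w (S x) (S y) \<le> a w * dist_at w x y)"

lemma ex_contraction_factor: "\<exists>a. contraction_factor a"
proof -
  obtain \<alpha> where \<alpha>: "\<alpha> \<in> L0_plus M" "L0_less M \<alpha> (L0_const M 1)"
    and S: "\<And>x y. x \<in> G \<Longrightarrow> y \<in> G \<Longrightarrow> L0_le M (rnorm (S x - S y)) (L0_mult M \<alpha> (rnorm (x - y)))"
    using contr by (auto simp: random_contractive_def)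
  obtain a where a[measurable]: "a \<in> borel_measurable M" and \<alpha>_eq: "\<alpha> = L0_class M a"
    using \<alpha>(1) by (auto simp: L0_plus_def elim: L0_cases)
  have "AE w in M. 0 \<le> a w"
    using \<alpha>(1) by (simp add: L0_plus_def \<alpha>_eq L0_le_class)
  moreover have "AE w in M. a w < 1"
  proof -
    obtain f g where fg: "AE w in M. a w = f w" "AE w in M. 1 = g w" "AE w in M. f w < g w"
      using \<alpha>(2) by (auto simp: L0_less_def \<alpha>_eq mem_L0_class)
    then show ?thesis by eventually_elim simp
  qed
  moreover have "AE w in M. dist_at w (S x) (S y) \<le> a w * dist_at w x y" if "x \<in> G" "y \<in> G" for x y
  proof -
    have "L0_mult M \<alpha> (rnorm (x - y)) = L0_class M (\<lambda>w. a w * nrm (x - y) w)"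
      by (simp only: rnorm_eq_nrm \<alpha>_eq) (subst L0_map2_class, auto)
    then show ?thesis
      using S[OF that] by (simp add: rnorm_eq_nrm L0_le_class dist_at_def)
  qed
  ultimately show ?thesis
    by (auto simp: contraction_factor_def)
qed

definition lip :: "'w \<Rightarrow> real" where
  "lip = (SOME a. contraction_factor a)"

lemma lip: "contraction_factor lip"
  unfolding lip_def by (rule someI_ex[OF ex_contraction_factor])

lemma lip_bounds: "AE w in M. 0 \<le> lip w \<and> lip w < 1"
  using lip by (simp add: contraction_factor_def)

lemma S_contr: "x \<in> G \<Longrightarrow> y \<in> G \<Longrightarrow> AE w in M. dist_at w (S x) (S y) \<le> lip w * dist_at w x y"
  using lip by (simp add: contraction_factor_def)

lemma dist_at_add: "dist_at w (x + z) (y + z) = dist_at w x y"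
  by (simp add: dist_at_def)

text \<open>Banach's iteration of \<open>u \<mapsto> S u + T y\<close>. The factor
  \<open>lip w\<close> may come arbitrarily close to 1 as \<open>w\<close> varies, so the geometric
  estimate is made at each \<open>w\<close> separately and yields an almost sure limit.\<close>

lemma ex_fixed_point:
  assumes y: "y \<in> G"
  shows "\<exists>x\<in>G. S x + T y = x"
proof -
  define x where "x = rec_nat y (\<lambda>_ u. S u + T y)"
  have xS: "x (Suc k) = S (x k) + T y" for k
    by (simp add: x_def)
  have x: "x k \<in> G" for k
    by (induction k) (simp_all add: x_def y S_T)
  have "AE w in M. \<forall>k. dist_at w (S (x (Suc k))) (S (x k)) \<le> lip w * dist_at w (x (Suc k)) (x k)"
    unfolding AE_all_countable by (intro allI S_contr x)
  moreover have "AE w in M. pmet_on (range x) w"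
    by (rule AE_pmet_on) auto
  ultimately have "AE w in M. \<forall>e>0. \<exists>N. \<forall>m\<ge>N. \<forall>n\<ge>N. dist_at w (x m) (x n) < e"
    using lip_bounds
  proof eventually_elim
    case (elim w)
    note pm = pmet_onD[OF elim(2)]
    define D where "D = dist_at w (x (Suc 0)) (x 0)"
    have D: "D \<ge> 0"
      using pm(1) by (simp add: D_def)
    have a: "0 \<le> lip w" "lip w < 1"
      using elim(3) by auto
    have 1: "dist_at w (x (Suc k)) (x k) \<le> lip w ^ k * D" for k
    proof (induction k)
      case (Suc k)
      have "dist_at w (x (Suc (Suc k))) (x (Suc k)) \<le> lip w * dist_at w (x (Suc k)) (x k)"
        using elim(1) by (simp add: xS dist_at_add)
      also have "\<dots> \<le> lip w * (lip w ^ k * D)"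
        using Suc a by (intro mult_left_mono)
      finally show ?case by simp
    qed (simp add: D_def)
    \<comment> \<open>The telescoped geometric sum, multiplied by \<open>1 - lip w\<close> to avoid
      division.\<close>
    have 2: "(1 - lip w) * dist_at w (x (m + k)) (x m) \<le> (lip w ^ m - lip w ^ (m + k)) * D" for m k
    proof (induction k)
      case 0
      then show ?case using pm(2)[of "x m" "x m"] by simp
    next
      case (Suc k)
      have "(1 - lip w) * dist_at w (x (m + Suc k)) (x m)
          \<le> (1 - lip w) * (dist_at w (x (Suc (m + k))) (x (m + k)) + dist_at w (x (m + k)) (x m))"
        using pm(4)[of "x (Suc (m + k))" "x (m + k)" "x m"] a by (intro mult_left_mono) auto
      also have "\<dots> \<le> (1 - lip w) * (lip w ^ (m + k) * D) + (lip w ^ m - lip w ^ (m + k)) * D"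
        unfolding distrib_left using 1[of "m + k"] Suc a by (intro add_mono mult_left_mono) auto
      also have "\<dots> = (lip w ^ m - lip w ^ (m + Suc k)) * D"
        by (simp add: algebra_simps)
      finally show ?case .
    qed
    show ?case
    proof (intro allI impI)
      fix e :: real assume "e > 0"
      have "(\<lambda>k. lip w ^ k * D) \<longlonglongrightarrow> 0"
        using tendsto_mult_right[OF LIMSEQ_realpow_zero[of "lip w"], of D] a by simp
      then obtain N where N: "lip w ^ N * D < (1 - lip w) * (e / 2)"
        using order_tendstoD(2)[of "\<lambda>k. lip w ^ k * D" 0 sequentially "(1 - lip w) * (e / 2)"] a \<open>e > 0\<close>
        by (auto simp: eventually_sequentially)
      have near: "dist_at w (x m) (x N) < e / 2" if "m \<ge> N" for m
      proof -
        have "(1 - lip w) * dist_at w (x m) (x N) \<le> (lip w ^ N - lip w ^ m) * D"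
          using 2[of N "m - N"] that by simp
        also have "\<dots> \<le> lip w ^ N * D"
          using a D by (intro mult_right_mono) auto
        also note N
        finally show ?thesis
          using a by (simp add: mult_less_cancel_left_pos)
      qed
      have "dist_at w (x m) (x n) < e" if "m \<ge> N" "n \<ge> N" for m n
        using near[OF that(1)] near[OF that(2)] pm(4)[of "x m" "x N" "x n"] pm(3)[of "x N" "x n"]
        by simp
      then show "\<exists>N. \<forall>m\<ge>N. \<forall>n\<ge>N. dist_at w (x m) (x n) < e" by blast
    qed
  qed
  from AE_complete[OF complete this] obtain l where l: "AE w in M. (\<lambda>k. dist_at w (x k) l) \<longlonglongrightarrow> 0"
    by blast
  have "l \<in> G"
    by (rule AE_closed[of G x l, OF closed x l])
  have "AE w in M. \<forall>k. dist_at w (S (x k)) (S l) \<le> lip w * dist_at w (x k) l"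
    unfolding AE_all_countable by (intro allI S_contr x \<open>l \<in> G\<close>)
  moreover have "AE w in M. pmet_on ({l, S l + T y} \<union> range x) w"
    by (rule AE_pmet_on) auto
  ultimately have "AE w in M. dist_at w (S l + T y) l = 0"
    using l
  proof eventually_elim
    case (elim w)
    note pm = pmet_onD[OF elim(2)]
    have "dist_at w (S l + T y) l \<le> lip w * dist_at w (x k) l + dist_at w (x (Suc k)) l" for k
    proof -
      have "dist_at w (x (Suc k)) (S l + T y) \<le> lip w * dist_at w (x k) l"
        using elim(1) by (simp add: xS dist_at_add)
      then show ?thesis
        using pm(4)[of "S l + T y" "x (Suc k)" l] pm(3)[of "x (Suc k)" "S l + T y"] by simp
    qed
    moreover have "(\<lambda>k. lip w * dist_at w (x k) l + dist_at w (x (Suc k)) l) \<longlonglongrightarrow> 0"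
      using tendsto_add[OF tendsto_mult_left[OF elim(3), of "lip w"] LIMSEQ_Suc[OF elim(3)]] by simp
    ultimately have "dist_at w (S l + T y) l \<le> 0"
      by (intro LIMSEQ_le_const) auto
    then show ?case
      using pm(1)[of "S l + T y" l] by simp
  qed
  with \<open>l \<in> G\<close> show ?thesis
    using dist_at_eq_0_imp by blast
qed

definition resolvent :: "'e \<Rightarrow> 'e" where
  "resolvent y = (SOME x. x \<in> G \<and> S x + T y = x)"

lemma resolvent:
  assumes "y \<in> G"
  shows "resolvent y \<in> G" "S (resolvent y) + T y = resolvent y"
  using someI_ex[of "\<lambda>x. x \<in> G \<and> S x + T y = x"] ex_fixed_point[OF assms] by (auto simp: resolvent_def)

text \<open>The two defining equations are subtracted and the \<open>S\<close> part is absorbed on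
  the left. This passes total boundedness and uniform continuity from \<open>T\<close> to the
  resolvent.\<close>

lemma resolvent_dist_le:
  assumes x: "x \<in> G" and y: "y \<in> G"
  shows "AE w in M. (1 - lip w) * dist_at w (resolvent x) (resolvent y) \<le> dist_at w (T x) (T y)"
proof -
  have eq: "resolvent x - resolvent y = (S (resolvent x) - S (resolvent y)) + (T x - T y)"
    using resolvent(2)[OF x] resolvent(2)[OF y] by (metis add_diff_add)
  have "AE w in M. nrm (resolvent x - resolvent y) w \<le> nrm (S (resolvent x) - S (resolvent y)) w + nrm (T x - T y) w"
    unfolding eq by (rule nrm_add)
  with S_contr[OF resolvent(1)[OF x] resolvent(1)[OF y]] show ?thesis
    by eventually_elim (simp add: dist_at_def algebra_simps)
qed

text \<open>The resolvent inherits compatibility with gluing from \<open>T\<close>. The estimate is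
  taken for all \<open>g i\<close> at once because the index \<open>n w\<close> depends on
  \<open>w\<close>.\<close>

lemma resolvent_glue:
  assumes "y \<in> G" "\<And>i. g i \<in> G" and y: "AE w in M. dist_at w (T y) (T (g (n w :: nat))) = 0"
  shows "AE w in M. dist_at w (resolvent y) (resolvent (g (n w))) = 0"
proof -
  have "AE w in M. \<forall>i. (1 - lip w) * dist_at w (resolvent y) (resolvent (g i)) \<le> dist_at w (T y) (T (g i))"
    unfolding AE_all_countable by (intro allI resolvent_dist_le assms)
  moreover have "AE w in M. \<forall>i. 0 \<le> dist_at w (resolvent y) (resolvent (g i))"
    unfolding AE_all_countable dist_at_def by (intro allI nrm_nonneg)
  ultimately show ?thesis
    using y lip_bounds
  proof eventually_elim
    case (elim w)
    then have "(1 - lip w) * dist_at w (resolvent y) (resolvent (g (n w))) \<le> (1 - lip w) * 0"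
      by (metis mult_zero_right)
    then have "dist_at w (resolvent y) (resolvent (g (n w))) \<le> 0"
      using elim(4) by (simp add: mult_le_0_iff)
    with elim(2) show ?case
      by (simp add: antisym)
  qed
qed

section \<open>Approximate fixed points of the resolvent\<close>

text \<open>The rational hull is countable and, at almost every \<open>w\<close>, totally bounded,
  so \<open>T_unif_cont\<close> applies to an enumeration of it.\<close>

lemma AE_rhull_unif_cont:
  assumes V: "countable V" "0 \<in> V" "\<And>x y. x \<in> V \<Longrightarrow> y \<in> V \<Longrightarrow> x + y \<in> V"
    "\<And>q x. q \<in> \<rat> \<Longrightarrow> x \<in> V \<Longrightarrow> sc q x \<in> V"
    and x: "\<And>i. i \<le> n \<Longrightarrow> x i \<in> V \<inter> G"
  shows "AE w in M. \<forall>\<eta>>0. \<exists>\<delta>>0. \<forall>u\<in>sc.rhull n x. \<forall>v\<in>sc.rhull n x.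
    dist_at w u v < \<delta> \<longrightarrow> dist_at w (T u) (T v) < \<eta>"
proof -
  have sub: "sc.rhull n x \<subseteq> V \<inter> G"
  proof (rule sc.rhull_subset)
    fix u v and q :: real assume "u \<in> V \<inter> G" "v \<in> V \<inter> G" "q \<in> \<rat>" "0 \<le> q" "q \<le> 1"
    then show "sc q u + sc (1 - q) v \<in> V \<inter> G"
      using L0_convexD[OF convex] V(3,4) by (auto intro!: V(3) V(4))
  qed fact
  then have "countable (sc.rhull n x)"
    using V(1) by (meson countable_Int1 countable_subset)
  moreover have "sc.rhull n x \<noteq> {}"
    using sc.cube_pt_in_rhull[of "\<lambda>_. 0" n x] by (auto simp: rcube_def)
  ultimately have "range (from_nat_into (sc.rhull n x)) = sc.rhull n x"
    by (intro range_from_nat_into)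
  then obtain g :: "nat \<Rightarrow> 'e" where g: "range g = sc.rhull n x" ..
  have gG: "g i \<in> G" for i
    using g sub by blast
  have "AE w in M. rational_seminorm sc V (\<lambda>x. nrm x w)"
    using V by (rule AE_rational_seminorm)
  then have "AE w in M. \<forall>e>0. \<exists>F. finite F \<and> (\<forall>i::nat. \<exists>j\<in>F. dist_at w (g i) (g j) < e)"
  proof eventually_elim
    case (elim w)
    interpret w: rational_seminorm sc V "\<lambda>x. nrm x w" by fact
    show ?case
    proof (intro allI impI)
      fix e :: real assume "e > 0"
      have "\<exists>F. finite F \<and> F \<subseteq> sc.rhull n x \<and> (\<forall>v\<in>sc.rhull n x. \<exists>u\<in>F. nrm (v - u) w < e)"
        by (rule w.rhull_totally_bounded) (use x \<open>e > 0\<close> in auto)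
      then obtain F where F: "finite F" "F \<subseteq> range g" "\<And>v. v \<in> range g \<Longrightarrow> \<exists>u\<in>F. dist_at w v u < e"
        unfolding g dist_at_def by blast
      obtain I where "finite I" "F = g ` I"
        using finite_subset_image[OF F(1,2)] by blast
      with F(3) show "\<exists>F. finite F \<and> (\<forall>i. \<exists>j\<in>F. dist_at w (g i) (g j) < e)"
        by (intro exI[of _ I]) auto
    qed
  qed
  from T_unif_cont[of g, OF gG this] show ?thesis
    unfolding g[symmetric] by simp
qed

lemma ex_approx_fixed_point:
  assumes "e > 0"
  shows "\<exists>u\<in>G. AE w in M. dist_at w u (resolvent u) < e"
proof -
  obtain x0 where "x0 \<in> G"
    using convex by (auto simp: L0_convex_def)
  obtain V where V: "countable V" "x0 \<in> V" "0 \<in> V" "\<And>x y. x \<in> V \<Longrightarrow> y \<in> V \<Longrightarrow> x + y \<in> V"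
    "\<And>q x. q \<in> \<rat> \<Longrightarrow> x \<in> V \<Longrightarrow> sc q x \<in> V" and RV: "\<And>x. x \<in> V \<Longrightarrow> resolvent x \<in> V"
    using countable_closure[of x0 resolvent] by metis
  \<comment> \<open>\<open>C\<close> is countable, closed under rational convex combinations and
    mapped into itself by the resolvent.\<close>
  define C where "C = V \<inter> G"
  have "countable C" "C \<noteq> {}"
    using V(1,2) \<open>x0 \<in> G\<close> by (auto simp: C_def)
  then have "range (from_nat_into C) = C"
    by (intro range_from_nat_into)
  then obtain g :: "nat \<Rightarrow> 'e" where g: "range g = C" ..
  have gG: "g i \<in> G" for i
    using g by (auto simp: C_def)
  have uc: "AE w in M. \<forall>xs\<in>lists C. \<forall>n. length xs = Suc n \<longrightarrow> (\<forall>\<eta>>0. \<exists>\<delta>>0.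
    \<forall>u\<in>sc.rhull n ((!) xs). \<forall>v\<in>sc.rhull n ((!) xs). dist_at w u v < \<delta> \<longrightarrow> dist_at w (T u) (T v) < \<eta>)"
  proof -
    have "AE w in M. length xs = Suc n \<longrightarrow> (\<forall>\<eta>>0. \<exists>\<delta>>0.
      \<forall>u\<in>sc.rhull n ((!) xs). \<forall>v\<in>sc.rhull n ((!) xs). dist_at w u v < \<delta> \<longrightarrow> dist_at w (T u) (T v) < \<eta>)"
      if xs: "xs \<in> lists C" for xs n
    proof (cases "length xs = Suc n")
      case True
      have "xs ! i \<in> V \<inter> G" if "i \<le> n" for i
        using xs that True nth_mem[of i xs] by (auto simp: C_def)
      then show ?thesis
        using AE_rhull_unif_cont[of V n "(!) xs"] V by simp
    qed simp
    then show ?thesis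
      using countable_lists[OF \<open>countable C\<close>] by (simp only: AE_ball_countable AE_all_countable) blast
  qed
  have "AE w in M. \<forall>x\<in>C. \<forall>y\<in>C. (1 - lip w) * dist_at w (resolvent x) (resolvent y) \<le> dist_at w (T x) (T y)"
    by (rule AE_countable_pairs[OF \<open>countable C\<close> \<open>countable C\<close> resolvent_dist_le]) (auto simp: C_def)
  moreover have "AE w in M. rational_seminorm sc V (\<lambda>x. nrm x w)"
    using V(1,3-5) by (rule AE_rational_seminorm)
  ultimately have "AE w in M. \<exists>x\<in>C. dist_at w x (resolvent x) < e"
    using uc lip_bounds T_totally_bounded[of g, OF gG]
  proof eventually_elim
    case (elim w)
    interpret w: rational_seminorm sc V "\<lambda>x. nrm x w" by (fact elim(2))
    have resolvent_less: "nrm (resolvent x - resolvent y) w < r" if "x \<in> C" "y \<in> C" "dist_at w (T x) (T y) < (1 - lip w) * r" for x y r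
    proof -
      have "(1 - lip w) * dist_at w (resolvent x) (resolvent y) < (1 - lip w) * r"
        using elim(1) that by fastforce
      then show ?thesis
        using elim(4) by (simp add: dist_at_def)
    qed
    have conv: "sc q x + sc (1 - q) y \<in> C" if "x \<in> C" "y \<in> C" "q \<in> \<rat>" "0 \<le> q" "q \<le> 1" for x y q
      using that L0_convexD[OF convex] by (auto simp: C_def intro!: V(4,5))
    have "\<exists>x\<in>C. nrm (x - resolvent x) w < e"
    proof (rule w.schauder_approx[OF _ \<open>C \<noteq> {}\<close> conv _ _ _ \<open>e > 0\<close>])
      show "C \<subseteq> V" by (simp add: C_def)
      show "resolvent x \<in> C" if "x \<in> C" for x
        using that resolvent(1) RV by (simp add: C_def)
      fix r :: real assume "r > 0"
      \<comment> \<open>At fixed \<open>w\<close> the factor \<open>1 - lip w\<close> is a positive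
        constant; a tolerance \<open>(1 - lip w) * r\<close> for \<open>T\<close> becomes the
        tolerance \<open>r\<close> for the resolvent.\<close>
      then have r: "(1 - lip w) * r > 0"
        using elim(4) by simp
      then obtain N :: nat where N: "\<forall>i. \<exists>j\<le>N. dist_at w (T (g i)) (T (g j)) < (1 - lip w) * r"
        using elim(5) by blast
      have "\<exists>y\<in>g ` {..N}. nrm (resolvent x - resolvent y) w < r" if "x \<in> C" for x
      proof -
        obtain i where x: "x = g i"
          using \<open>x \<in> C\<close> g by blast
        obtain j where "j \<le> N" "dist_at w (T (g i)) (T (g j)) < (1 - lip w) * r"
          using N by blast
        with resolvent_less[of "g i" "g j" r] g show ?thesis
          unfolding x by blast
      qed
      then show "\<exists>F. finite F \<and> F \<subseteq> C \<and> (\<forall>x\<in>C. \<exists>y\<in>F. nrm (resolvent x - resolvent y) w < r)"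
        using g by (intro exI[of _ "g ` {..N}"]) auto
      fix xs n assume xs: "set xs \<subseteq> C" "length xs = Suc n"
      then have "xs \<in> lists C" by auto
      with elim(3) xs(2) r obtain \<delta> where \<delta>: "\<delta> > 0" "\<forall>u\<in>sc.rhull n ((!) xs). \<forall>v\<in>sc.rhull n ((!) xs).
          dist_at w u v < \<delta> \<longrightarrow> dist_at w (T u) (T v) < (1 - lip w) * r"
        by blast
      have "sc.rhull n ((!) xs) \<subseteq> C"
      proof (rule sc.rhull_subset[OF conv])
        show "xs ! i \<in> C" if "i \<le> n" for i
          using xs that nth_mem[of i xs] by auto
      qed
      with \<delta> resolvent_less show "\<exists>\<delta>>0. \<forall>u\<in>sc.rhull n ((!) xs). \<forall>v\<in>sc.rhull n ((!) xs).
          nrm (u - v) w < \<delta> \<longrightarrow> nrm (resolvent u - resolvent v) w < r"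
        unfolding dist_at_def by (intro exI[of _ \<delta>]) blast
    qed
    then show ?case
      by (simp add: dist_at_def)
  qed
  then have ex: "AE w in M. \<exists>i. dist_at w (g i) (resolvent (g i)) < e"
    by eventually_elim (use g in blast)
  \<comment> \<open>The approximate fixed point found depends on \<open>w\<close>; taking the first
    in the enumeration makes its index measurable.\<close>
  define k where "k w = (LEAST i. dist_at w (g i) (resolvent (g i)) < e)" for w
  have k: "k \<in> measurable M (count_space UNIV)"
    unfolding k_def by measurable
  obtain u where u: "u \<in> G" "AE w in M. dist_at w u (g (k w)) = 0"
    "AE w in M. dist_at w (T u) (T (g (k w))) = 0"
    by (rule glue[of g k]) (use gG k in auto)
  have "AE w in M. dist_at w (resolvent u) (resolvent (g (k w))) = 0"
    by (rule resolvent_glue[of u g k, OF u(1) gG u(3)])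
  moreover have "AE w in M. pmet_on ({u, resolvent u} \<union> range g \<union> range (\<lambda>i. resolvent (g i))) w"
    by (rule AE_pmet_on) auto
  ultimately have "AE w in M. dist_at w u (resolvent u) < e"
    using u(2) ex
  proof eventually_elim
    case (elim w)
    have "dist_at w u (resolvent u) = dist_at w (g (k w)) (resolvent u)"
      by (rule pmet_on_eq(1)[OF elim(2)]) (use elim(3) in auto)
    also have "\<dots> = dist_at w (g (k w)) (resolvent (g (k w)))"
      by (rule pmet_on_eq(2)[OF elim(2)]) (use elim(1) in auto)
    also have "\<dots> < e"
      unfolding k_def by (rule LeastI_ex[OF elim(4)])
    finally show ?case .
  qed
  with u(1) show ?thesis by blast
qed

text \<open>Compactness makes the images under \<open>T\<close> of glued approximate fixed points
  \<open>v k\<close> converge, hence their resolvents are Cauchy with a limit \<open>x\<close> in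
  \<open>G\<close>. The \<open>v k\<close> tend to \<open>x\<close> too, and continuity of
  \<open>T\<close> identifies \<open>x\<close> as a fixed point of the resolvent.\<close>

lemma fixed_point: "\<exists>x\<in>G. S x + T x = x"
proof -
  have "\<forall>m. \<exists>u. u \<in> G \<and> (AE w in M. dist_at w u (resolvent u) < 1 / real (Suc m))"
    using ex_approx_fixed_point[of "1 / real (Suc m)" for m] by (metis of_nat_0_less_iff zero_less_Suc zero_less_divide_1_iff)
  then obtain u where u: "\<And>m. u m \<in> G" "\<And>m. AE w in M. dist_at w (u m) (resolvent (u m)) < 1 / real (Suc m)"
    by metis
  obtain n :: "nat \<Rightarrow> 'w \<Rightarrow> nat" and l where n: "\<And>k. n k \<in> measurable M (count_space UNIV)"
      "\<And>w. w \<in> space M \<Longrightarrow> strict_mono (\<lambda>k. n k w)"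
    and l: "AE w in M. (\<lambda>k. dist_at w (T (u (n k w))) l) \<longlonglongrightarrow> 0"
    by (rule T_compact_AE[of u]) (use u(1) in auto)
  obtain v where v: "\<And>k. v k \<in> G" "AE w in M. \<forall>k. dist_at w (v k) (u (n k w)) = 0"
    "AE w in M. \<forall>k. dist_at w (T (v k)) (T (u (n k w))) = 0"
    by (rule glue_seq[of u n]) (use u n in auto)
  have Rv: "AE w in M. \<forall>k. dist_at w (resolvent (v k)) (resolvent (u (n k w))) = 0"
    unfolding AE_all_countable
  proof
    fix k
    show "AE w in M. dist_at w (resolvent (v k)) (resolvent (u (n k w))) = 0"
      using v(3) by (intro resolvent_glue v(1) u(1)) (simp add: AE_all_countable)
  qed
  have pm: "AE w in M. pmet_on (range v \<union> range u \<union> range (\<lambda>k. resolvent (v k)) \<union> range (\<lambda>i. resolvent (u i))) w"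
    by (rule AE_pmet_on) auto
  have "AE w in M. \<forall>m. dist_at w (u m) (resolvent (u m)) < 1 / real (Suc m)"
    unfolding AE_all_countable using u(2) by blast
  then have near: "AE w in M. \<forall>k. dist_at w (v k) (resolvent (v k)) \<le> 1 / real (Suc k)"
    using v(2) Rv pm AE_space
  proof eventually_elim
    case (elim w)
    show ?case
    proof
      fix k
      have "dist_at w (v k) (resolvent (v k)) = dist_at w (u (n k w)) (resolvent (v k))"
        by (rule pmet_on_eq(1)[OF elim(4)]) (use elim(2) in auto)
      also have "\<dots> = dist_at w (u (n k w)) (resolvent (u (n k w)))"
        by (rule pmet_on_eq(2)[OF elim(4)]) (use elim(3) in auto)
      also have "\<dots> \<le> 1 / real (Suc (n k w))"
        using elim(1) by (simp add: less_imp_le)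
      \<comment> \<open>Strictly increasing indices satisfy \<open>k \<le> n k w\<close>, so gluing
        does not worsen the error bound.\<close>
      also have "\<dots> \<le> 1 / real (Suc k)"
        using strict_mono_imp_increasing[OF n(2)[OF elim(5)], of k] by (simp add: frac_le)
      finally show "dist_at w (v k) (resolvent (v k)) \<le> 1 / real (Suc k)" .
    qed
  qed
  have "AE w in M. \<forall>j\<in>UNIV. \<forall>k\<in>UNIV. (1 - lip w) * dist_at w (resolvent (v j)) (resolvent (v k)) \<le> dist_at w (T (v j)) (T (v k))"
    by (rule AE_countable_pairs) (auto intro: resolvent_dist_le v(1))
  moreover have "AE w in M. pmet_on ({l} \<union> range (\<lambda>k. T (v k)) \<union> range (\<lambda>i. T (u i))) w"
    by (rule AE_pmet_on) auto
  ultimately have "AE w in M. \<forall>e>0. \<exists>N. \<forall>j\<ge>N. \<forall>k\<ge>N. dist_at w (resolvent (v j)) (resolvent (v k)) < e"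
    using l v(3) lip_bounds
  proof eventually_elim
    case (elim w)
    note pm = pmet_onD[OF elim(2)]
    show ?case
    proof (intro allI impI)
      fix e :: real assume "e > 0"
      then have e: "(1 - lip w) * e / 2 > 0"
        using elim(5) by simp
      obtain N where N: "\<And>k. k \<ge> N \<Longrightarrow> dist_at w (T (u (n k w))) l < (1 - lip w) * e / 2"
        using order_tendstoD(2)[OF elim(3) e] by (auto simp: eventually_sequentially)
      have Tv: "dist_at w (T (v k)) l < (1 - lip w) * e / 2" if "k \<ge> N" for k
        using N[OF that] pmet_on_eq(1)[OF elim(2), of "T (v k)" "T (u (n k w))" l] elim(4) by auto
      have "dist_at w (resolvent (v j)) (resolvent (v k)) < e" if "j \<ge> N" "k \<ge> N" for j k
      proof -
        have "(1 - lip w) * dist_at w (resolvent (v j)) (resolvent (v k)) \<le> dist_at w (T (v j)) (T (v k))"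
          using elim(1) by blast
        also have "\<dots> < (1 - lip w) * e"
          using Tv[OF that(1)] Tv[OF that(2)] pm(4)[of "T (v j)" l "T (v k)"] pm(3)[of l "T (v k)"] by simp
        finally show ?thesis
          using elim(5) by simp
      qed
      then show "\<exists>N. \<forall>j\<ge>N. \<forall>k\<ge>N. dist_at w (resolvent (v j)) (resolvent (v k)) < e" by blast
    qed
  qed
  from AE_complete[OF complete this] obtain x where x: "AE w in M. (\<lambda>k. dist_at w (resolvent (v k)) x) \<longlonglongrightarrow> 0"
    by blast
  have "x \<in> G"
    by (rule AE_closed[of G "\<lambda>k. resolvent (v k)" x, OF closed resolvent(1)[OF v(1)] x])
  have pm: "AE w in M. pmet_on ({x, resolvent x} \<union> range v \<union> range (\<lambda>k. resolvent (v k))) w"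
    by (rule AE_pmet_on) auto
  have "AE w in M. (\<lambda>k. dist_at w (v k) x) \<longlonglongrightarrow> 0"
    using x near pm
  proof eventually_elim
    case (elim w)
    note pm = pmet_onD[OF elim(3)]
    show ?case
    proof (rule tendsto_sandwich[OF _ _ tendsto_const])
      show "(\<lambda>k. 1 / real (Suc k) + dist_at w (resolvent (v k)) x) \<longlonglongrightarrow> 0"
        using tendsto_add[OF LIMSEQ_Suc[OF lim_1_over_n[where 'a=real]] elim(1)] by simp
      have "dist_at w (v k) x \<le> 1 / real (Suc k) + dist_at w (resolvent (v k)) x" for k
        using pm(4)[of "v k" "resolvent (v k)" x] elim(2)[rule_format, of k] by simp
      then show "\<forall>\<^sub>F k in sequentially. dist_at w (v k) x \<le> 1 / real (Suc k) + dist_at w (resolvent (v k)) x"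
        by simp
    qed (use pm(1) in auto)
  qed
  then have Tx: "AE w in M. (\<lambda>k. dist_at w (T (v k)) (T x)) \<longlonglongrightarrow> 0"
    by (rule T_cont_AE[of v x, OF v(1) \<open>x \<in> G\<close>])
  have "AE w in M. \<forall>k. (1 - lip w) * dist_at w (resolvent (v k)) (resolvent x) \<le> dist_at w (T (v k)) (T x)"
    unfolding AE_all_countable by (intro allI resolvent_dist_le v(1) \<open>x \<in> G\<close>)
  then have "AE w in M. dist_at w (resolvent x) x = 0"
    using x Tx pm lip_bounds
  proof eventually_elim
    case (elim w)
    note pm = pmet_onD[OF elim(4)]
    \<comment> \<open>The left-hand side does not depend on \<open>k\<close>, while both terms on
      the right tend to 0.\<close>
    have "(1 - lip w) * dist_at w (resolvent x) x \<le> dist_at w (T (v k)) (T x) + (1 - lip w) * dist_at w (resolvent (v k)) x" for k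
    proof -
      have "(1 - lip w) * dist_at w (resolvent x) x \<le> (1 - lip w) * (dist_at w (resolvent (v k)) (resolvent x) + dist_at w (resolvent (v k)) x)"
        using pm(4)[of "resolvent x" "resolvent (v k)" x] pm(3)[of "resolvent x" "resolvent (v k)"] elim(5) by (intro mult_left_mono) auto
      also have "\<dots> \<le> dist_at w (T (v k)) (T x) + (1 - lip w) * dist_at w (resolvent (v k)) x"
        unfolding distrib_left using elim(1) by simp
      finally show ?thesis .
    qed
    moreover have "(\<lambda>k. dist_at w (T (v k)) (T x) + (1 - lip w) * dist_at w (resolvent (v k)) x) \<longlonglongrightarrow> 0"
      using tendsto_add[OF elim(3) tendsto_mult_left[OF elim(2), of "1 - lip w"]] by simp
    ultimately have "(1 - lip w) * dist_at w (resolvent x) x \<le> 0"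
      by (intro LIMSEQ_le_const) auto
    then have "dist_at w (resolvent x) x \<le> 0"
      using elim(5) by (simp add: mult_le_0_iff)
    then show ?case
      using pm(1)[of "resolvent x" x] by simp
  qed
  then have "resolvent x = x"
    by (rule dist_at_eq_0_imp)
  with resolvent(2)[OF \<open>x \<in> G\<close>] \<open>x \<in> G\<close> show ?thesis by auto
qed

end

theorem theorem1p15:
  fixes M :: "'w measure"
    and smul :: "('w \<Rightarrow> 'k::{real_normed_field,euclidean_space}) set \<Rightarrow> 'e::ab_group_add \<Rightarrow> 'e"
    and rnorm :: "'e \<Rightarrow> ('w \<Rightarrow> real) set"
    and G :: "'e set"
    and S T :: "'e \<Rightarrow> 'e"
  assumes "rn_module M smul rnorm"
    and "el_complete M rnorm TYPE('e)"
    and "closedin (el_topology M rnorm) G"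
    and "L0_convex M smul G"
    and "random_contractive M rnorm G S"
    and "sigma_stable_map M smul G UNIV T"
    and "random_seq_continuous M smul rnorm G T"
    and "random_rel_seq_compact M smul rnorm (T ` G)"
    and "\<forall>x\<in>G. \<forall>y\<in>G. S x + T y \<in> G"
  shows "\<exists>x\<in>G. S x + T x = x"
proof -
  interpret krasnoselskii M smul rnorm G S T
    using assms by (intro krasnoselskii.intro krasnoselskii_axioms.intro) auto
  show ?thesis
    by (rule fixed_point)
qed

end
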